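(* Let $S$ be an irreducible system in $n$ variables with $m$ equations in which each equation contains at most $r$ variables. Let $k$ be a positive integer with $n\ge (k-1)r+1$, and let $w_{\min}$ be the minimum weight of an equation of $S$. Then in time $m^{O(1)}$ one can find an assignment $x^0\in\{-1,1\}^n$ such that $\varepsilon_S(x^0)\ge k\cdot w_{\min}$.
   Context: A weighted system $S$ consists of equations $\prod_{i\in I_j}x_i=b_j$, $j=1,\dots,m$, in variables $x_1,\dots,x_n$, where $\emptyset\ne I_j\subseteq[n]$, $x_i,b_j\in\{-1,1\}$, and equation $j$ has a positive integral weight $w_j$. The excess of $x^0\in\{-1,1\}^n$ is $\varepsilon_S(x^0)=\sum_{j=1}^m w_jb_j\prod_{i\in I_j}x^0_i$. Rule 1: if for some $I\subseteq[n]$ there are two equations $\prod_{i\in I}x_i=b'$ with weight $w'$ and $\prod_{i\in I}x_i=b''$ with weight $w''$, replace this pair by one of these equations with weight $w'+w''$ if $b'=b''$, and otherwise by the equation of larger weight with new weight equal to the difference of the two weights; if the resulting weight is $0$, delete the equation. Rule 2: let $A$ be the $m\times n$ matrix over $\mathbb{F}_2$ with $a_{ji}=1$ iff $i\in I_j$; let $t=\mathrm{rank}A$ and let columns $a^{i_1},\dots,a^{i_t}$ of $A$ be linearly independent; delete all variables not in $\{x_{i_1},\dots,x_{i_t}\}$ from the equations of $S$. A system is irreducible if it cannot be changed by Rule 1 or Rule 2. *)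

theory Defs
  imports "Jordan_Normal_Form.DL_Rank" "HOL-Library.Z2"
begin

section \<open>Weighted systems\<close>

text \<open>
  \<open>Equation I b w\<close> is the equation \<open>(\<Prod>i\<in>I. x i) = b\<close> of weight \<open>w\<close>. A system carries its set of
  variables explicitly: a variable need not occur in any equation, and such a variable
  still counts as a variable of the system.
\<close>

datatype equation = Equation (supp: "nat set") (rhs: int) (weight: int)

datatype wsystem = WSystem (vars: "nat set") (eqs: "equation list")

definition weighted_system :: "wsystem \<Rightarrow> bool" where
  "weighted_system S \<longleftrightarrow> finite (vars S) \<and>
     (\<forall>e\<in>set (eqs S). supp e \<noteq> {} \<and> supp e \<subseteq> vars S \<and> rhs e \<in> {-1, 1} \<and> weight e > 0)"

definition excess :: "wsystem \<Rightarrow> (nat \<Rightarrow> int) \<Rightarrow> int" where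
  "excess S x =
     (\<Sum>j<length (eqs S). weight (eqs S ! j) * rhs (eqs S ! j) * (\<Prod>i\<in>supp (eqs S ! j). x i))"

definition min_weight :: "wsystem \<Rightarrow> int" where
  "min_weight S = Min (weight ` set (eqs S))"

section \<open>Reduction rules\<close>

definition merge :: "equation \<Rightarrow> equation \<Rightarrow> equation list" where
  "merge e e' =
     (if rhs e = rhs e' then [Equation (supp e) (rhs e) (weight e + weight e')]
      else if weight e > weight e' then [Equation (supp e) (rhs e) (weight e - weight e')]
      else if weight e' > weight e then [Equation (supp e') (rhs e') (weight e' - weight e)]
      else [])"

inductive rule1 :: "wsystem \<Rightarrow> wsystem \<Rightarrow> bool" where
  "supp e = supp e' \<Longrightarrow>
     rule1 (WSystem V (xs @ e # ys @ e' # zs)) (WSystem V (xs @ merge e e' @ ys @ zs))"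

definition coeff_col :: "wsystem \<Rightarrow> nat \<Rightarrow> bit vec" where
  "coeff_col S i = vec (length (eqs S)) (\<lambda>j. if i \<in> supp (eqs S ! j) then 1 else 0)"

definition coeff_mat :: "wsystem \<Rightarrow> bit mat" where
  "coeff_mat S = mat_of_cols (length (eqs S)) (map (coeff_col S) (sorted_list_of_set (vars S)))"

definition coeff_rank :: "wsystem \<Rightarrow> nat" where
  "coeff_rank S = vec_space.rank (length (eqs S)) (coeff_mat S)"

text \<open>
  The columns indexed by \<open>B\<close> are required to be linearly independent as a family; since
  independence in the library is a property of a set of vectors, injectivity is stated separately.
\<close>

definition indep_cols :: "wsystem \<Rightarrow> nat set \<Rightarrow> bool" where
  "indep_cols S B \<longleftrightarrow> inj_on (coeff_col S) B \<and>
     \<not> module.lin_dep class_ring (module_vec TYPE(bit) (length (eqs S))) (coeff_col S ` B)"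

text \<open>
  Deleting the variables outside \<open>B\<close> also removes them from the variable set of the system, so
  that a variable occurring in no equation does not survive the rule.
\<close>

inductive rule2 :: "wsystem \<Rightarrow> wsystem \<Rightarrow> bool" where
  "B \<subseteq> vars S \<Longrightarrow> card B = coeff_rank S \<Longrightarrow> indep_cols S B \<Longrightarrow>
     rule2 S (WSystem B (map (\<lambda>e. Equation (supp e \<inter> B) (rhs e) (weight e)) (eqs S)))"

definition irreducible_system :: "wsystem \<Rightarrow> bool" where
  "irreducible_system S \<longleftrightarrow> (\<forall>S'. rule1 S S' \<or> rule2 S S' \<longrightarrow> S' = S)"

section \<open>Random access programs with unit-cost time\<close>

text \<open>
  The memory consists of integer arrays addressed by name; a scalar variable is cell 0 of its array.
  A program mentions only finitely many names and expressions, so charging one unit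
  for each assignment and each test agrees, up to a factor depending only on the program, with
  counting every memory access and every arithmetic operation. Only addition and subtraction are
  primitive: in \<open>t\<close> steps the bit length of the largest number in memory grows by \<open>O(t)\<close>, with a
  constant depending on the program, so unit cost cannot conceal superpolynomial work.
\<close>

type_synonym store = "string \<Rightarrow> int \<Rightarrow> int"

datatype aexp = Const int | Read string aexp | Add aexp aexp | Sub aexp aexp

datatype bexp = Less aexp aexp | Neg bexp | Conj bexp bexp

datatype com =
    Skip
  | Assign string aexp aexp
  | Seq com com
  | Cond bexp com com
  | While bexp com

fun aval :: "aexp \<Rightarrow> store \<Rightarrow> int" where
  "aval (Const c) s = c"
| "aval (Read a e) s = s a (aval e s)"
| "aval (Add e e') s = aval e s + aval e' s"
| "aval (Sub e e') s = aval e s - aval e' s"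

fun bval :: "bexp \<Rightarrow> store \<Rightarrow> bool" where
  "bval (Less e e') s \<longleftrightarrow> aval e s < aval e' s"
| "bval (Neg b) s \<longleftrightarrow> \<not> bval b s"
| "bval (Conj b b') s \<longleftrightarrow> bval b s \<and> bval b' s"

text \<open>\<open>exec c s t s'\<close>: started in \<open>s\<close>, the program \<open>c\<close> terminates in \<open>s'\<close> after exactly \<open>t\<close> steps.\<close>

inductive exec :: "com \<Rightarrow> store \<Rightarrow> nat \<Rightarrow> store \<Rightarrow> bool" where
  Skip: "exec Skip s 1 s"
| Assign: "exec (Assign a p e) s 1 (s(a := (s a)(aval p s := aval e s)))"
| Seq: "exec c s t s' \<Longrightarrow> exec c' s' t' s'' \<Longrightarrow> exec (Seq c c') s (t + t') s''"
| CondTrue: "bval b s \<Longrightarrow> exec c s t s' \<Longrightarrow> exec (Cond b c c') s (1 + t) s'"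
| CondFalse: "\<not> bval b s \<Longrightarrow> exec c' s t s' \<Longrightarrow> exec (Cond b c c') s (1 + t) s'"
| WhileFalse: "\<not> bval b s \<Longrightarrow> exec (While b c) s 1 s"
| WhileTrue: "bval b s \<Longrightarrow> exec c s t s' \<Longrightarrow> exec (While b c) s' t' s'' \<Longrightarrow>
    exec (While b c) s (1 + t + t') s''"

lemma exec_deterministic:
  "exec c s t s' \<Longrightarrow> exec c s u s'' \<Longrightarrow> u = t \<and> s'' = s'"
proof (induction arbitrary: u s'' rule: exec.induct)
  case Skip
  then show ?case by cases auto
next
  case Assign
  then show ?case by cases auto
next
  case Seq
  from Seq.prems show ?case by cases (metis Seq.IH)
next
  case CondTrue
  from CondTrue.prems show ?case by cases (use CondTrue.IH CondTrue.hyps in metis)+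
next
  case CondFalse
  from CondFalse.prems show ?case by cases (use CondFalse.IH CondFalse.hyps in metis)+
next
  case WhileFalse
  from WhileFalse.prems show ?case by cases (use WhileFalse.hyps in simp_all)
next
  case WhileTrue
  from WhileTrue.prems show ?case by cases (use WhileTrue.IH WhileTrue.hyps in metis)+
qed

section \<open>Input and output conventions\<close>

text \<open>
  A system on the variables \<open>{0..<n}\<close> with \<open>m\<close> equations is given by \<open>n\<close>, \<open>m\<close>, its
  incidence matrix in row-major order (the entry of row \<open>j\<close> and column \<open>i\<close> in cell \<open>j * n + i\<close> of the
  array \<open>A\<close>), its right-hand sides \<open>b\<close> and its weights \<open>w\<close>. All other cells are 0.
\<close>

definition input_store :: "wsystem \<Rightarrow> nat \<Rightarrow> nat \<Rightarrow> store" where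
  "input_store S r k =
    (let n = card (vars S); m = length (eqs S) in
     (\<lambda>_ _. 0)
      (''n'' := (\<lambda>_. 0)(0 := int n),
       ''m'' := (\<lambda>_. 0)(0 := int m),
       ''r'' := (\<lambda>_. 0)(0 := int r),
       ''k'' := (\<lambda>_. 0)(0 := int k),
       ''A'' := (\<lambda>p. if 0 \<le> p \<and> p < int (m * n) \<and> nat p mod n \<in> supp (eqs S ! (nat p div n))
                     then 1 else 0),
       ''b'' := (\<lambda>p. if 0 \<le> p \<and> p < int m then rhs (eqs S ! nat p) else 0),
       ''w'' := (\<lambda>p. if 0 \<le> p \<and> p < int m then weight (eqs S ! nat p) else 0)))"

definition output_assignment :: "store \<Rightarrow> nat \<Rightarrow> int" where
  "output_assignment s i = s ''x'' (int i)"

end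

theory Submission
  imports Defs
begin

text \<open>
  Irreducibility makes the left-hand sides distinct vectors that span the whole space. Write the
  all-ones vector as a sum of equations from a basis consisting of equations. As long as the
  expansion of some equation has at least two more basis elements inside this sum than outside,
  exchanging the equation for one of those inside shortens the sum. When no such exchange is
  possible, an equation all of whose basis elements occur in the sum is itself one of the summands.
  The sum has at least \<open>k\<close> terms because each equation has at most \<open>r\<close> of the \<open>n > (k - 1) * r\<close>
  variables.

  Now take the basis elements as new variables. In these the excess is a multilinear polynomial
  vanishing at 0. Giving the variables values \<open>1\<close> or \<open>-1\<close> one by one, those occurring in the sum
  first, never decreases it if the sign is chosen well. Each variable in the sum contributes the
  full weight of its own equation, since by the previous paragraph every other equation containing
  it still contains a variable with value 0.
\<close>

section \<open>A program logic with polynomial time bounds\<close>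

text \<open>The danger in fixing new variables one by one is that several equations are decided at
  the same moment, and the others may outweigh the basis equation just served. The exchange removes
  this danger. Replacing a basis element \<open>p\<close> of the sum by an equation toggles the
  membership of every other basis element in its expansion, while position \<open>p\<close> remains
  in the sum. The length therefore changes by outside minus inside plus one, which is why a surplus
  of two is needed. Once no exchange is left, an equation lying entirely inside the sum has surplus
  equal to its number of basis elements, so it consists of one basis element, and distinctness of
  the equations identifies it with that basis equation. The length is at most \<open>n\<close>
  initially, so at most \<open>n\<close> sweeps can be productive. Carrying the unit vectors through
  the same column operations yields the original variables as products of the new ones, so no linear
  system has to be solved afterwards. Independence of the columns also gives
  \<open>n \<le> m\<close>, hence a time bound in \<open>m\<close> alone.\<close>

primrec writes :: "com \<Rightarrow> string set" where
  "writes Skip = {}"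
| "writes (Assign a p e) = {a}"
| "writes (Seq c d) = writes c \<union> writes d"
| "writes (Cond b c d) = writes c \<union> writes d"
| "writes (While b c) = writes c"

lemma exec_unchanged: "exec c s t s' \<Longrightarrow> a \<notin> writes c \<Longrightarrow> s' a = s a"
  by (induction rule: exec.induct) auto

text \<open>
  With time bounds that are powers of a fixed base \<open>K\<close>, sequencing, branching and loops with at most
  \<open>(K - 2) / 3\<close> iterations only raise the exponent.
\<close>

definition achieves :: "nat \<Rightarrow> com \<Rightarrow> nat \<Rightarrow> (store \<Rightarrow> bool) \<Rightarrow> store \<Rightarrow> bool" where
  "achieves K c d Q s \<longleftrightarrow> (\<exists>t s'. exec c s t s' \<and> t \<le> K ^ d \<and> Q s')"

lemma achieves_mono:
  assumes "achieves K c d Q s" "\<And>s'. Q s' \<Longrightarrow> \<forall>a. a \<notin> writes c \<longrightarrow> s' a = s a \<Longrightarrow> Q' s'" "d \<le> d'" "1 \<le> K"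
  shows "achieves K c d' Q' s"
  using assms unfolding achieves_def
  by (meson exec_unchanged order_trans power_increasing)

lemma achieves_Skip: "Q s \<Longrightarrow> 1 \<le> K \<Longrightarrow> achieves K Skip d Q s"
  unfolding achieves_def using exec.Skip one_le_power by blast

lemma achieves_Assign:
  "Q (s(a := (s a)(aval p s := aval e s))) \<Longrightarrow> 1 \<le> K \<Longrightarrow> achieves K (Assign a p e) d Q s"
  unfolding achieves_def using exec.Assign one_le_power by blast

lemma power_sum_le:
  assumes "i < d" "j < d" "2 \<le> (K::nat)"
  shows "K ^ i + K ^ j \<le> K ^ d"
proof -
  obtain d' where d: "d = Suc d'" using assms(1) by (cases d) auto
  have "K ^ i \<le> K ^ d'" "K ^ j \<le> K ^ d'" using assms d by (auto intro!: power_increasing)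
  then have "K ^ i + K ^ j \<le> 2 * K ^ d'" by simp
  also have "\<dots> \<le> K ^ d" using assms(3) d by simp
  finally show ?thesis .
qed

lemma achieves_Seq:
  assumes "achieves K c i Q s"
    and "\<And>s'. Q s' \<Longrightarrow> \<forall>a. a \<notin> writes c \<longrightarrow> s' a = s a \<Longrightarrow> achieves K c' j Q' s'"
    and "i < d" "j < d" "2 \<le> K"
  shows "achieves K (Seq c c') d Q' s"
proof -
  obtain t s' where 1: "exec c s t s'" "t \<le> K ^ i" "Q s'"
    using assms(1) unfolding achieves_def by blast
  then have "achieves K c' j Q' s'" using assms(2) exec_unchanged by blast
  then obtain u s'' where 2: "exec c' s' u s''" "u \<le> K ^ j" "Q' s''"
    unfolding achieves_def by blast
  have "t + u \<le> K ^ d" using 1 2 power_sum_le[OF assms(3-5)] by linarith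
  then show ?thesis using 1 2 exec.Seq unfolding achieves_def by blast
qed

lemma achieves_Cond:
  assumes "bval b s \<Longrightarrow> achieves K c i Q s" "\<not> bval b s \<Longrightarrow> achieves K c' i Q s"
    and "i < d" "2 \<le> K"
  shows "achieves K (Cond b c c') d Q s"
proof -
  have le: "1 + t \<le> K ^ d" if "t \<le> K ^ i" for t
    using that power_sum_le[of 0 d i K] assms(3,4) by simp
  show ?thesis
    using assms(1,2) le exec.CondTrue exec.CondFalse unfolding achieves_def
    by (cases "bval b s") blast+
qed

abbreviation V :: "string \<Rightarrow> aexp" where "V a \<equiv> Read a (Const 0)"

abbreviation Set :: "string \<Rightarrow> aexp \<Rightarrow> com" where "Set a e \<equiv> Assign a (Const 0) e"

definition For :: "string \<Rightarrow> string \<Rightarrow> com \<Rightarrow> com" where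
  "For i b c = Seq (Set i (Const 0))
     (While (Less (V i) (V b)) (Seq c (Set i (Add (V i) (Const 1)))))"

lemma writes_For [simp]: "writes (For i b c) = insert i (writes c)"
  by (auto simp: For_def)

text \<open>An iteration costs its body plus one test and one increment; initialisation and the last
  test cost two more. The total \<open>L * (K ^ j + 2) + 2\<close> is at most
  \<open>(3 * L + 2) * K ^ j\<close>, so a loop raises the exponent by one. The invariant is
  required after the increment, hence it may mention the counter.\<close>

lemma achieves_For:
  assumes bound: "s b 0 = int L" "3 * L + 2 \<le> K"
    and fresh: "i \<notin> writes c" "b \<notin> writes c" "i \<noteq> b"
    and init: "I 0 (s(i := (s i)(0 := 0)))"
    and step: "\<And>l s'. l < L \<Longrightarrow> I l s' \<Longrightarrow> s' i 0 = int l \<Longrightarrow>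
        \<forall>a. a \<notin> insert i (writes c) \<longrightarrow> s' a = s a \<Longrightarrow>
        achieves K c j (\<lambda>s''. I (Suc l) (s''(i := (s'' i)(0 := int (Suc l))))) s'"
    and post: "\<And>s'. I L s' \<Longrightarrow> \<forall>a. a \<notin> insert i (writes c) \<longrightarrow> s' a = s a \<Longrightarrow> Q s'"
    and d: "j < d"
  shows "achieves K (For i b c) d Q s"
proof -
  let ?w = "While (Less (V i) (V b)) (Seq c (Set i (Add (V i) (Const 1))))"
  have loop: "\<exists>t s''. exec ?w s' t s'' \<and> t \<le> (L - l) * (K ^ j + 2) + 1 \<and> I L s'' \<and>
      (\<forall>a. a \<notin> insert i (writes c) \<longrightarrow> s'' a = s a)"
    if "l \<le> L" "I l s'" "s' i 0 = int l" "\<forall>a. a \<notin> insert i (writes c) \<longrightarrow> s' a = s a" for l s'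
    using that
  proof (induction "L - l" arbitrary: l s')
    case 0
    then have "s' b 0 = int L" "l = L" using bound(1) fresh by auto
    then have "\<not> bval (Less (V i) (V b)) s'" using 0(4) by simp
    from exec.WhileFalse[OF this] show ?case using 0(3,5) \<open>l = L\<close> by (intro exI[of _ 1] exI[of _ s']) simp
  next
    case (Suc k)
    then have l: "l < L" by simp
    have g: "bval (Less (V i) (V b)) s'" using Suc.prems(3,4) bound(1) fresh l by simp
    obtain t s1 where 1: "exec c s' t s1" "t \<le> K ^ j" "I (Suc l) (s1(i := (s1 i)(0 := int (Suc l))))"
      using step[OF l Suc.prems(2-4)] unfolding achieves_def by blast
    define s2 where "s2 = s1(i := (s1 i)(0 := int (Suc l)))"
    have s1: "s1 a = s' a" if "a \<notin> writes c" for a using exec_unchanged[OF 1(1) that] .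
    have "exec (Set i (Add (V i) (Const 1))) s1 1 s2"
      using exec.Assign[of i "Const 0" "Add (V i) (Const 1)" s1] s1[of i] fresh(1) Suc.prems(3)
      by (simp add: s2_def add.commute)
    then have b: "exec (Seq c (Set i (Add (V i) (Const 1)))) s' (t + 1) s2" using 1 exec.Seq by blast
    have "\<exists>t s''. exec ?w s2 t s'' \<and> t \<le> (L - Suc l) * (K ^ j + 2) + 1 \<and> I L s'' \<and>
      (\<forall>a. a \<notin> insert i (writes c) \<longrightarrow> s'' a = s a)"
    proof (rule Suc.hyps(1))
      show "k = L - Suc l" using Suc.hyps(2) by simp
      show "Suc l \<le> L" using l by simp
      show "I (Suc l) s2" using 1(3) by (simp only: s2_def)
      show "s2 i 0 = int (Suc l)" by (simp add: s2_def)
      show "\<forall>a. a \<notin> insert i (writes c) \<longrightarrow> s2 a = s a" using s1 Suc.prems(4) by (simp add: s2_def)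
    qed
    then obtain u s3 where 3: "exec ?w s2 u s3" "u \<le> (L - Suc l) * (K ^ j + 2) + 1" "I L s3"
      "\<forall>a. a \<notin> insert i (writes c) \<longrightarrow> s3 a = s a" by blast
    have "L - l = Suc (L - Suc l)" using l by simp
    then have "1 + (t + 1) + u \<le> (L - l) * (K ^ j + 2) + 1" using 1(2) 3(2) by simp
    then show ?case using exec.WhileTrue[OF g b 3(1)] 3 by blast
  qed
  let ?s = "s(i := (s i)(0 := 0))"
  obtain t s' where w: "exec ?w ?s t s'" "t \<le> L * (K ^ j + 2) + 1" "I L s'"
      "\<forall>a. a \<notin> insert i (writes c) \<longrightarrow> s' a = s a"
    using loop[of 0 ?s, OF _ init] by auto
  have "exec (Set i (Const 0)) s 1 ?s" using exec.Assign[of i "Const 0" "Const 0" s] by simp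
  then have e: "exec (For i b c) s (1 + t) s'" unfolding For_def using w exec.Seq by blast
  have K: "1 \<le> K ^ j" using bound by simp
  then have "1 + t \<le> L * (K ^ j + 2 * K ^ j) + 2 * K ^ j"
    using w(2) add_mono[OF mult_le_mono2[of "K ^ j + 2" "K ^ j + 2 * K ^ j" L], of 2 "2 * K ^ j"] by linarith
  also have "\<dots> = (3 * L + 2) * K ^ j" by (simp add: algebra_simps)
  also have "\<dots> \<le> K ^ Suc j" using mult_le_mono1[OF bound(2), of "K ^ j"] by simp
  also have "\<dots> \<le> K ^ d" using d bound(2) by (intro power_increasing) auto
  finally show ?thesis using e post w(3,4) unfolding achieves_def by blast
qed

section \<open>Pivoting\<close>

text \<open>These two rules would take ring terms over \<open>bit\<close> out of the reach of the algebraic simplification rules.\<close>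

declare add_bit_eq_xor [simp del] mult_bit_eq_and [simp del]

type_synonym tableau = "nat \<Rightarrow> nat \<Rightarrow> bit"

text \<open>Columns are coordinates with respect to the current basis. If \<open>T j p = 1\<close>,
  the expansion of row \<open>j\<close> can be solved for basis element \<open>p\<close>;
  substituting the result adds column \<open>p\<close> to every column \<open>q\<close> with
  \<open>T j q = 1\<close>, and column \<open>p\<close> now belongs to row \<open>j\<close>.\<close>

definition pivot :: "tableau \<Rightarrow> nat \<Rightarrow> nat \<Rightarrow> tableau" where
  "pivot T j p = (\<lambda>l q. if q = p then T l q else T l q + T j q * T l p)"

text \<open>The test \<open>C\<close> sees the tableau as left by the earlier pivots of the same
  sweep, exactly as the nested loops of the program do.\<close>

definition sweep :: "nat \<Rightarrow> nat \<Rightarrow> (tableau \<Rightarrow> nat \<Rightarrow> nat \<Rightarrow> bool) \<Rightarrow> tableau \<Rightarrow> tableau" where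
  "sweep n m C = fold (\<lambda>p. fold (\<lambda>j T. if T j p = 1 \<and> C T j p then pivot T j p else T) [0..<m]) [0..<n]"

lemma sweep_invariant:
  assumes "P T" "\<And>T j p. P T \<Longrightarrow> j < m \<Longrightarrow> p < n \<Longrightarrow> T j p = 1 \<Longrightarrow> P (pivot T j p)"
  shows "P (sweep n m C T)"
proof -
  have "P (fold (\<lambda>j T. if T j p = 1 \<and> C T j p then pivot T j p else T) [0..<m] T)"
    if "P T" "p < n" for T p
    by (rule fold_invariant[where Q = "\<lambda>j. j < m" and P = P]) (use that assms(2) in auto)
  then show ?thesis
    unfolding sweep_def using assms(1) fold_invariant[where Q = "\<lambda>p. p < n" and P = P and xs = "[0..<n]"]
    by simp
qed

text \<open>A drop of the potential cannot be undone by later steps. Without a drop no step has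
  changed anything, so every step was evaluated at the initial value itself.\<close>

lemma fold_fixed_or_decreasing:
  fixes \<phi> :: "'b \<Rightarrow> int"
  assumes "\<And>x T. x \<in> set xs \<Longrightarrow> g x T = T \<or> \<phi> (g x T) < \<phi> T"
  shows "fold g xs T = T \<and> (\<forall>x\<in>set xs. g x T = T) \<or> \<phi> (fold g xs T) < \<phi> T"
  using assms
proof (induction xs arbitrary: T)
  case (Cons x xs)
  have "fold g xs (g x T) = g x T \<and> (\<forall>z\<in>set xs. g z (g x T) = g x T) \<or> \<phi> (fold g xs (g x T)) < \<phi> (g x T)"
    using Cons by simp
  moreover have "g x T = T \<or> \<phi> (g x T) < \<phi> T" using Cons.prems by simp
  ultimately show ?case by auto
qed simp

lemma bit_add_eq_0_iff: "a + b = 0 \<longleftrightarrow> a = b" for a b :: bit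
  by (cases a; cases b) simp_all

text \<open>A sign squares to 1, so only the parity of its exponent matters. This is the bridge from
  addition over \<open>bit\<close> to multiplication of signs.\<close>

lemma prod_if_bit_sum:
  fixes s :: int and a :: "'a \<Rightarrow> bit"
  assumes "s \<in> {-1, 1}" "finite I"
  shows "(\<Prod>i\<in>I. if a i = 1 then s else 1) = (if (\<Sum>i\<in>I. a i) = 1 then s else 1)"
  using assms(2)
proof (induction rule: finite_induct)
  case (insert i I)
  then show ?case using assms(1) by (cases "a i"; cases "sum a I") auto
qed simp

text \<open>The matrix form of an irreducible system. Rule 2 enters through \<open>cols\<close>: a
  trivial kernel means independent columns, and dually that the rows span. Rule 1 enters through
  \<open>rows_distinct\<close>.\<close>

locale maxlin =
  fixes n m :: nat and A :: tableau and w b :: "nat \<Rightarrow> int"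
  assumes cols: "(\<And>j. j < m \<Longrightarrow> (\<Sum>i<n. A j i * v i) = 0) \<Longrightarrow> i < n \<Longrightarrow> v i = 0"
    and rows_nonzero: "j < m \<Longrightarrow> \<exists>i<n. A j i = 1"
    and rows_distinct: "j < m \<Longrightarrow> j' < m \<Longrightarrow> (\<And>i. i < n \<Longrightarrow> A j i = A j' i) \<Longrightarrow> j = j'"
    and w_pos: "j < m \<Longrightarrow> 0 < w j"
    and b_sign: "j < m \<Longrightarrow> b j \<in> {-1, 1}"
begin

text \<open>
  Row \<open>m\<close> is the all-ones vector; the unit rows \<open>m + 1 + i\<close> record the change of variables.
\<close>

definition T0 :: tableau where
  "T0 l i = (if l < m then A l i else if l = m then 1 else of_bool (l = m + 1 + i))"

text \<open>With M the block of unit rows, the clauses express that the other rows are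
  \<open>T0\<close> times M, that the change of coordinates creates no new relations between rows,
  and that the equation rows keep a trivial kernel. Each clause survives a column operation by
  direct calculation, so no inverse of M has to be constructed.\<close>

definition valid :: "tableau \<Rightarrow> bool" where
  "valid T \<longleftrightarrow>
     (\<forall>l\<le>m. \<forall>q<n. T l q = (\<Sum>i<n. T0 l i * T (m + 1 + i) q)) \<and>
     (\<forall>J. (\<forall>q<n. (\<Sum>l\<in>J. T l q) = 0) \<longrightarrow> (\<forall>q<n. (\<Sum>l\<in>J. T0 l q) = 0)) \<and>
     (\<forall>v. (\<forall>j<m. (\<Sum>q<n. T j q * v q) = 0) \<longrightarrow> (\<forall>q<n. v q = 0))"

lemma valid_row:
  assumes "valid T" "l \<le> m" "q < n"
  shows "T l q = (\<Sum>i<n. T0 l i * T (m + 1 + i) q)"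
  using assms(1)[unfolded valid_def, THEN conjunct1] assms(2,3) by blast

lemma valid_relation:
  assumes "valid T" "\<And>q. q < n \<Longrightarrow> (\<Sum>l\<in>J. T l q) = 0" "q < n"
  shows "(\<Sum>l\<in>J. T0 l q) = 0"
  using assms(1)[unfolded valid_def, THEN conjunct2, THEN conjunct1, THEN spec, of J] assms(2,3) by blast

lemma valid_cols:
  assumes "valid T" "\<And>j. j < m \<Longrightarrow> (\<Sum>q<n. T j q * v q) = 0" "q < n"
  shows "v q = 0"
  using assms(1)[unfolded valid_def, THEN conjunct2, THEN conjunct2, THEN spec, of v] assms(2,3) by blast

lemma valid_T0: "valid T0"
proof -
  have 1: "T0 l q = (\<Sum>i<n. T0 l i * T0 (m + 1 + i) q)" if "q < n" for l q
  proof -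
    have "(\<Sum>i<n. T0 l i * T0 (m + 1 + i) q) = (\<Sum>i<n. if i = q then T0 l i else 0)"
      by (rule sum.cong) (auto simp: T0_def)
    also have "\<dots> = T0 l q" using that by simp
    finally show ?thesis by (rule sym)
  qed
  have 2: "\<forall>q<n. v q = 0" if "\<forall>j<m. (\<Sum>q<n. T0 j q * v q) = 0" for v
  proof (intro allI impI, rule cols[of v])
    show "(\<Sum>i<n. A j i * v i) = 0" if "j < m" for j
      using \<open>\<forall>j<m. (\<Sum>q<n. T0 j q * v q) = 0\<close>[rule_format, OF that] that by (simp add: T0_def)
  qed
  show ?thesis
    unfolding valid_def by (intro conjI allI impI) (rule 1, assumption, blast, use 2 in blast)
qed

text \<open>A pivot adds multiples of column \<open>p\<close> to the other columns. This operation
  is invertible whatever the value of \<open>T j p\<close>, so that entry need not be 1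
  here.\<close>

lemma valid_pivot:
  assumes "valid T" "p < n"
  shows "valid (pivot T j p)"
proof -
  have 1: "T l q = (\<Sum>i<n. T0 l i * T (m + 1 + i) q)" if "l \<le> m" "q < n" for l q
    using valid_row[OF assms(1) that] .
  have "pivot T j p l q = (\<Sum>i<n. T0 l i * pivot T j p (m + 1 + i) q)" if "l \<le> m" "q < n" for l q
  proof (cases "q = p")
    case False
    have "pivot T j p l q = T l q + T j q * T l p" using False by (simp add: pivot_def)
    also have "\<dots> = (\<Sum>i<n. T0 l i * T (m + 1 + i) q) + T j q * (\<Sum>i<n. T0 l i * T (m + 1 + i) p)"
      using 1[OF that] 1[OF that(1) assms(2)] by simp
    also have "\<dots> = (\<Sum>i<n. T0 l i * (T (m + 1 + i) q + T j q * T (m + 1 + i) p))"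
      by (simp add: sum_distrib_left sum.distrib algebra_simps)
    finally show ?thesis using False by (simp add: pivot_def)
  qed (use 1 that in \<open>simp add: pivot_def\<close>)
  moreover have "\<forall>q<n. (\<Sum>l\<in>J. T0 l q) = 0" if J: "\<forall>q<n. (\<Sum>l\<in>J. pivot T j p l q) = 0" for J
  proof -
    have p: "(\<Sum>l\<in>J. T l p) = 0" using J assms(2) by (auto simp: pivot_def)
    have "(\<Sum>l\<in>J. T l q) = 0" if "q < n" for q
    proof (cases "q = p")
      case False
      have "0 = (\<Sum>l\<in>J. T l q + T j q * T l p)" using J that False by (auto simp: pivot_def)
      also have "\<dots> = (\<Sum>l\<in>J. T l q) + T j q * (\<Sum>l\<in>J. T l p)"
        by (simp add: sum.distrib sum_distrib_left)
      finally show ?thesis using p by simp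
    qed (use p in simp)
    then show ?thesis using valid_relation[OF assms(1)] by blast
  qed
  moreover have "\<forall>q<n. v q = 0" if v: "\<forall>l<m. (\<Sum>q<n. pivot T j p l q * v q) = 0" for v
  proof -
    \<comment> \<open>Applying the pivoted rows to \<open>v\<close> is the same as applying the old
      rows to \<open>v'\<close>: the copies of column \<open>p\<close> inside the other columns are
      collected in coordinate \<open>p\<close>.\<close>
    define v' where "v' = v(p := v p + (\<Sum>q\<in>{..<n} - {p}. T j q * v q))"
    have "(\<Sum>q<n. T l q * v' q) = 0" if "l < m" for l
    proof -
      have "(\<Sum>q<n. T l q * v' q) = T l p * v' p + (\<Sum>q\<in>{..<n} - {p}. T l q * v' q)"
        using assms(2) by (intro sum.remove) auto
      also have "(\<Sum>q\<in>{..<n} - {p}. T l q * v' q) = (\<Sum>q\<in>{..<n} - {p}. T l q * v q)"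
        by (rule sum.cong) (auto simp: v'_def)
      also have "T l p * v' p + (\<Sum>q\<in>{..<n} - {p}. T l q * v q) =
          T l p * v p + (\<Sum>q\<in>{..<n} - {p}. (T l q + T j q * T l p) * v q)"
        by (simp add: v'_def sum_distrib_left sum.distrib algebra_simps)
      also have "(\<Sum>q\<in>{..<n} - {p}. (T l q + T j q * T l p) * v q) =
          (\<Sum>q\<in>{..<n} - {p}. pivot T j p l q * v q)"
        by (rule sum.cong) (auto simp: pivot_def)
      also have "T l p * v p + \<dots> = (\<Sum>q<n. pivot T j p l q * v q)"
        using assms(2) sum.remove[of "{..<n}" p "\<lambda>q. pivot T j p l q * v q"]
        by (simp add: pivot_def[of T j p, THEN fun_cong, THEN fun_cong, of l p])
      finally show ?thesis using v that by simp
    qed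
    then have v': "v' q = 0" if "q < n" for q
      using valid_cols[OF assms(1)] that by blast
    then have z: "v q = 0" if "q < n" "q \<noteq> p" for q using that v'_def by (metis fun_upd_other)
    then have "(\<Sum>q\<in>{..<n} - {p}. T j q * v q) = 0" by (intro sum.neutral) auto
    then have "v p = 0" using v'[OF assms(2)] by (simp add: v'_def)
    then show ?thesis using z by metis
  qed
  ultimately show ?thesis unfolding valid_def by (intro conjI allI impI) blast+
qed

section \<open>Reaching a basis that consists of equations\<close>

definition unit :: "tableau \<Rightarrow> nat \<Rightarrow> nat \<Rightarrow> bool" where
  "unit T j p \<longleftrightarrow> (\<forall>q<n. T j q = of_bool (q = p))"

lemma unit_pivot_same: "T j p = 1 \<Longrightarrow> unit (pivot T j p) j p"
  unfolding unit_def pivot_def by (auto simp: bit_add_eq_0_iff)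

lemma unit_pivot_other: "unit T j' p' \<Longrightarrow> p < n \<Longrightarrow> p \<noteq> p' \<Longrightarrow> unit (pivot T j p) j' p'"
  unfolding unit_def pivot_def by auto

text \<open>A pivot in column \<open>p'\<close> makes row \<open>j\<close> the unit row there; a
  pivot in another column leaves the old unit row alone, because that row has entry 0 in the pivot
  column.\<close>

lemma ex_unit_pivot:
  assumes "\<exists>j'<m. unit T j' p'" "T j p = 1" "p < n" "j < m"
  shows "\<exists>j'<m. unit (pivot T j p) j' p'"
  using assms unit_pivot_same unit_pivot_other by (cases "p = p'") blast+

text \<open>Otherwise the unit vector with its 1 at position \<open>p\<close> would be a nonzero
  element of the kernel.\<close>

lemma ex_unit_column:
  assumes "valid T" "p < n"
  shows "\<exists>j<m. T j p = 1"
proof (rule ccontr)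
  assume n: "\<not> ?thesis"
  have "(\<Sum>q<n. T j q * of_bool (q = p)) = 0" if "j < m" for j
    using that n by (intro sum.neutral) (auto simp: of_bool_def)
  then have "(of_bool (p = p) :: bit) = 0"
    using valid_cols[OF assms(1), of "\<lambda>q. of_bool (q = p)"] assms(2) by blast
  then show False by simp
qed

text \<open>Column \<open>p\<close> is constant while it is being processed, so the 1 it must
  contain is eventually met. Further pivots in that column only exchange one equation for another,
  and the columns done before keep their equations.\<close>

lemma units_sweep_all:
  "\<forall>p<n. \<exists>j<m. unit (sweep n m (\<lambda>_ _ _. True) T0) j p"
proof -
  let ?g = "\<lambda>p j T. if T j p = (1::bit) \<and> True then pivot T j p else T"
  have col: "valid (fold (?g p) [0..<m] T) \<and> (\<forall>p'<Suc p. \<exists>j<m. unit (fold (?g p) [0..<m] T) j p')"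
    if T: "valid T" "\<forall>p'<p. \<exists>j<m. unit T j p'" and p: "p < n" for p T
  proof -
    \<comment> \<open>The last conjunct follows the rows scanned so far: one of them is the unit row
      of column \<open>p\<close>, or all of them have entry 0 there. At \<open>j = m\<close> the
      second case contradicts \<open>ex_unit_column\<close>.\<close>
    have "valid (fold (?g p) [0..<j] T) \<and> (\<forall>p'<p. \<exists>i<m. unit (fold (?g p) [0..<j] T) i p') \<and>
      ((\<exists>j'<j. unit (fold (?g p) [0..<j] T) j' p) \<or> (\<forall>j'<j. fold (?g p) [0..<j] T j' p = 0))"
      if "j \<le> m" for j
      using that
    proof (induction j)
      case 0
      show ?case using T by simp
    next
      case (Suc j)
      define S where "S = fold (?g p) [0..<j] T"
      have IH: "valid S" "\<forall>p'<p. \<exists>j<m. unit S j p'" "(\<exists>j'<j. unit S j' p) \<or> (\<forall>j'<j. S j' p = 0)"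
        using Suc by (simp_all add: S_def)
      have S': "fold (?g p) [0..<Suc j] T = ?g p j S" by (simp add: S_def)
      show ?case unfolding S'
      proof (cases "S j p = 1")
        case True
        then show "valid (?g p j S) \<and> (\<forall>p'<p. \<exists>i<m. unit (?g p j S) i p') \<and>
          ((\<exists>j'<Suc j. unit (?g p j S) j' p) \<or> (\<forall>j'<Suc j. ?g p j S j' p = 0))"
          using IH valid_pivot[OF IH(1) p] ex_unit_pivot[where T = S, OF _ True p] unit_pivot_same[where T = S, OF True] Suc.prems
          by auto
      next
        case False
        then show "valid (?g p j S) \<and> (\<forall>p'<p. \<exists>i<m. unit (?g p j S) i p') \<and>
          ((\<exists>j'<Suc j. unit (?g p j S) j' p) \<or> (\<forall>j'<Suc j. ?g p j S j' p = 0))"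
          using IH less_Suc_eq by auto
      qed
    qed
    from this[of m] have F: "valid (fold (?g p) [0..<m] T)"
      "\<forall>p'<p. \<exists>i<m. unit (fold (?g p) [0..<m] T) i p'" "\<exists>i<m. unit (fold (?g p) [0..<m] T) i p"
      using ex_unit_column[OF _ p, of "fold (?g p) [0..<m] T"] by auto
    then have "\<exists>i<m. unit (fold (?g p) [0..<m] T) i p'" if "p' < Suc p" for p'
    proof (cases "p' = p")
      case True
      then show ?thesis using F(3) by blast
    next
      case False
      then have "p' < p" using that by simp
      then show ?thesis using F(2) by blast
    qed
    then show ?thesis using F(1) by blast
  qed
  have "valid (fold (\<lambda>p. fold (?g p) [0..<m]) [0..<P] T0) \<and>
    (\<forall>p<P. \<exists>j<m. unit (fold (\<lambda>p. fold (?g p) [0..<m]) [0..<P] T0) j p)" if "P \<le> n" for P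
    using that
  proof (induction P)
    case 0
    show ?case using valid_T0 by simp
  next
    case (Suc P)
    then show ?case using col[of "fold (\<lambda>p. fold (?g p) [0..<m]) [0..<P] T0" P] by simp
  qed
  from this[of n] show ?thesis unfolding sweep_def by simp
qed

section \<open>Shortening the expansion of the all-ones vector\<close>

abbreviation val :: "bit \<Rightarrow> int" where "val a \<equiv> of_bool (a = 1)"

definition target_size :: "tableau \<Rightarrow> int" where
  "target_size T = (\<Sum>q<n. val (T m q))"

text \<open>The factor is 1 for a basis element inside the current sum and -1 for one outside, so
  this is the surplus of inside over outside in the expansion of row \<open>j\<close>.\<close>

definition balance :: "tableau \<Rightarrow> nat \<Rightarrow> int" where
  "balance T j = (\<Sum>q<n. val (T j q) * (2 * val (T m q) - 1))"

definition shrinks :: "tableau \<Rightarrow> nat \<Rightarrow> nat \<Rightarrow> bool" where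
  "shrinks T j p \<longleftrightarrow> T m p = 1 \<and> 1 < balance T j"

text \<open>In row \<open>m\<close> the pivot toggles all basis elements of row \<open>j\<close>
  except \<open>p\<close>. Toggling \<open>p\<close> as well would change the size by minus the
  balance; the summand 1 restores \<open>p\<close>. So \<open>1 < balance T j\<close> is precisely
  the condition for a strict decrease.\<close>

lemma target_size_pivot:
  assumes "T j p = 1" "T m p = 1" "p < n"
  shows "target_size (pivot T j p) = target_size T - balance T j + 1"
proof -
  have "val (pivot T j p m q) = val (T m q) - val (T j q) * (2 * val (T m q) - 1) + of_bool (q = p)"
    if "q < n" for q
    using assms by (cases "T j q"; cases "T m q") (auto simp: pivot_def)
  then have "target_size (pivot T j p) = (\<Sum>q<n. val (T m q) - val (T j q) * (2 * val (T m q) - 1) + of_bool (q = p))"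
    unfolding target_size_def by (intro sum.cong) auto
  also have "\<dots> = target_size T - balance T j + (\<Sum>q<n. of_bool (q = p))"
    by (simp add: target_size_def balance_def sum.distrib sum_subtractf)
  also have "(\<Sum>q<n. of_bool (q = p)) = (1::int)" using assms(3) by (simp add: of_bool_def)
  finally show ?thesis .
qed

text \<open>The dichotomy of \<open>fold_fixed_or_decreasing\<close> is applied to the rows of a
  column and then to the columns. A sweep without decrease thus certifies that every pair failed the
  test on one and the same tableau.\<close>

lemma sweep_shrinks:
  "sweep n m shrinks T = T \<and> (\<forall>j<m. \<forall>p<n. T j p = 1 \<longrightarrow> \<not> shrinks T j p) \<or>
   target_size (sweep n m shrinks T) < target_size T"
proof -
  let ?g = "\<lambda>p j T. if T j p = 1 \<and> shrinks T j p then pivot T j p else T"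
  have g: "?g p j T = T \<and> \<not> (T j p = 1 \<and> shrinks T j p) \<or> target_size (?g p j T) < target_size T"
    if "p < n" for p j T
    using target_size_pivot[OF _ _ that] by (auto simp: shrinks_def)
  have G: "fold (?g p) [0..<m] T = T \<and> (\<forall>j\<in>set [0..<m]. ?g p j T = T) \<or>
      target_size (fold (?g p) [0..<m] T) < target_size T" if "p < n" for p T
    using g[OF that] by (intro fold_fixed_or_decreasing) blast
  have "fold (\<lambda>p. fold (?g p) [0..<m]) [0..<n] T = T \<and> (\<forall>p\<in>set [0..<n]. fold (?g p) [0..<m] T = T) \<or>
      target_size (fold (\<lambda>p. fold (?g p) [0..<m]) [0..<n] T) < target_size T"
    using G by (intro fold_fixed_or_decreasing) fastforce
  then show ?thesis
  proof
    assume *: "fold (\<lambda>p. fold (?g p) [0..<m]) [0..<n] T = T \<and> (\<forall>p\<in>set [0..<n]. fold (?g p) [0..<m] T = T)"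
    have no: "\<not> (T j p = 1 \<and> shrinks T j p)" if jp: "j < m" "p < n" for j p
    proof -
      have "fold (?g p) [0..<m] T = T" using * jp by simp
      then have "?g p j T = T" using G[OF jp(2), of T] jp by auto
      then show ?thesis using g[OF jp(2), where j = j and T = T] by auto
    qed
    have "sweep n m shrinks T = T" using * by (simp add: sweep_def)
    then show ?thesis using no by blast
  qed (simp add: sweep_def)
qed

definition final :: tableau where
  "final = fold (\<lambda>_. sweep n m shrinks) [0..<n] (sweep n m (\<lambda>_ _ _. True) T0)"

lemma final_invariant:
  assumes "P (sweep n m (\<lambda>_ _ _. True) T0)"
    "\<And>T j p. P T \<Longrightarrow> j < m \<Longrightarrow> p < n \<Longrightarrow> T j p = 1 \<Longrightarrow> P (pivot T j p)"
  shows "P final"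
  unfolding final_def
  by (rule fold_invariant[where Q = "\<lambda>_. True" and P = P]) (use assms sweep_invariant[where P = P] in blast)+

lemma valid_final: "valid final"
  by (rule final_invariant, rule sweep_invariant) (auto intro: valid_T0 valid_pivot)

lemma final_units:
  assumes "p < n"
  shows "\<exists>j<m. unit final j p"
  by (rule final_invariant) (use assms units_sweep_all ex_unit_pivot in auto)

text \<open>A sweep that changes the tableau lowers the size by at least 1. Since the size is at
  most \<open>n\<close> at the start and never negative, \<open>n\<close> sweeps end in a tableau
  that a further sweep leaves unchanged, or in size 0, where no decrease is possible.\<close>

lemma final_balance:
  assumes "j < m" "p < n" "final j p = 1" "final m p = 1"
  shows "balance final j \<le> 1"
proof -
  define F where "F i = fold (\<lambda>_. sweep n m shrinks) [0..<i] (sweep n m (\<lambda>_ _ _. True) T0)" for i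
  have nonneg: "0 \<le> target_size T" for T unfolding target_size_def by (intro sum_nonneg) auto
  have "sweep n m shrinks (F i) = F i \<or> target_size (F i) + int i \<le> int n" for i
  proof (induction i)
    case 0
    have "target_size (F 0) \<le> (\<Sum>q<n. 1)" unfolding target_size_def by (intro sum_mono) auto
    then show ?case by simp
  next
    case (Suc i)
    have "F (Suc i) = sweep n m shrinks (F i)" by (simp add: F_def)
    then show ?case using Suc sweep_shrinks[of "F i"] by auto
  qed
  from this[of n] have "sweep n m shrinks final = final \<or> target_size final \<le> 0"
    by (simp add: F_def final_def)
  then have "\<not> target_size (sweep n m shrinks final) < target_size final"
    using nonneg[of "sweep n m shrinks final"] by auto
  then have "\<not> shrinks final j p" using sweep_shrinks[of final] assms by blast
  then show ?thesis using assms by (simp add: shrinks_def)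
qed

section \<open>Uniqueness of basis equations and the length of the sum\<close>

text \<open>Two equations with the same unit row add up to zero. The relation already holds in the
  original coordinates, where it makes their supports equal.\<close>

lemma unit_unique:
  assumes "valid T" "j < m" "j' < m" "unit T j p" "unit T j' p"
  shows "j = j'"
proof (rule ccontr)
  assume "j \<noteq> j'"
  then have "\<forall>q<n. (\<Sum>l\<in>{j, j'}. T l q) = 0" using assms by (simp add: unit_def)
  then have "\<forall>q<n. (\<Sum>l\<in>{j, j'}. T0 l q) = 0" using valid_relation[OF assms(1)] by blast
  then have "A j q = A j' q" if "q < n" for q
    using that \<open>j \<noteq> j'\<close> assms by (simp add: T0_def bit_add_eq_0_iff)
  then show False using rows_distinct assms \<open>j \<noteq> j'\<close> by blast
qed

text \<open>Row \<open>m\<close> is the sum of the basis equations it selects. Transferred to the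
  original coordinates, this relation expresses the all-ones vector, so every variable occurs in a
  selected equation, and counting incidences gives the bound.\<close>

lemma target_size_bound:
  assumes "\<And>j. j < m \<Longrightarrow> (\<Sum>i<n. val (A j i)) \<le> r"
  shows "int n \<le> target_size final * r"
proof -
  obtain J where J: "J p < m" "unit final (J p) p" if "p < n" for p using final_units by metis
  define C where "C = {p. p < n \<and> final m p = 1}"
  have fin: "finite C" by (simp add: C_def)
  have inj: "inj_on J C"
  proof (rule inj_onI)
    fix p p' assume "p \<in> C" "p' \<in> C" "J p = J p'"
    then have "unit final (J p) p" "unit final (J p') p'" "p < n" using J unfolding C_def by blast+
    then have "unit final (J p) p" "unit final (J p) p'" "p < n" using \<open>J p = J p'\<close> by simp_all
    then show "p = p'" unfolding unit_def by (metis of_bool_eq_iff)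
  qed
  have m: "m \<notin> J ` C" using J C_def by auto
  have "(\<Sum>l\<in>insert m (J ` C). final l q) = 0" if "q < n" for q
  proof -
    have "(\<Sum>l\<in>J ` C. final l q) = (\<Sum>p\<in>C. final (J p) q)" using inj by (simp add: sum.reindex)
    also have "\<dots> = (\<Sum>p\<in>C. if p = q then 1 else 0)"
      using J that by (intro sum.cong) (auto simp: C_def unit_def)
    also have "\<dots> = final m q" using fin that by (simp add: C_def)
    finally show ?thesis using fin m by simp
  qed
  then have z: "(\<Sum>l\<in>insert m (J ` C). T0 l q) = 0" if "q < n" for q
    using valid_relation[OF valid_final _ that] by blast
  have ex: "\<exists>p\<in>C. A (J p) q = 1" if "q < n" for q
  proof (rule ccontr)
    assume "\<not> ?thesis"
    then have "(\<Sum>l\<in>J ` C. T0 l q) = 0" using J by (intro sum.neutral) (auto simp: T0_def C_def)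
    then show False using z[OF that] fin m by (simp add: T0_def)
  qed
  have "int n = (\<Sum>q<n. 1)" by simp
  also have "\<dots> \<le> (\<Sum>q<n. \<Sum>p\<in>C. val (A (J p) q))"
  proof (rule sum_mono)
    fix q assume "q \<in> {..<n}"
    then obtain p where "p \<in> C" "A (J p) q = 1" using ex by auto
    then show "1 \<le> (\<Sum>p\<in>C. val (A (J p) q))"
      using fin member_le_sum[of p C "\<lambda>p. val (A (J p) q)"] by simp
  qed
  also have "\<dots> = (\<Sum>p\<in>C. \<Sum>q<n. val (A (J p) q))" by (rule sum.swap)
  also have "\<dots> \<le> (\<Sum>p\<in>C. r)" using assms J by (intro sum_mono) (auto simp: C_def)
  also have "\<dots> = int (card C) * r" by simp
  also have "int (card C) = target_size final"
    unfolding target_size_def C_def by (simp add: sum.If_cases of_bool_def Int_def)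
  finally show ?thesis .
qed

section \<open>Greedy assignment\<close>

text \<open>For an equation row this is its left-hand side in the new variables; for the unit row
  \<open>m + 1 + i\<close> it is the value of the original variable \<open>i\<close>.\<close>

definition rowprod :: "tableau \<Rightarrow> (nat \<Rightarrow> int) \<Rightarrow> nat \<Rightarrow> int" where
  "rowprod T y l = (\<Prod>q<n. if T l q = 1 then y q else 1)"

text \<open>An unassigned variable has value 0, so that equations containing it do not count.\<close>

definition gain :: "tableau \<Rightarrow> (nat \<Rightarrow> int) \<Rightarrow> int" where
  "gain T y = (\<Sum>j<m. w j * b j * rowprod T y j)"

text \<open>The value 1 is compared with the unassigned state instead of the value -1. As the former
  state is the mean of the two choices, this decides which sign is better at the price of one new
  evaluation.\<close>

definition greedy :: "tableau \<Rightarrow> nat \<Rightarrow> (nat \<Rightarrow> int) \<Rightarrow> nat \<Rightarrow> int" where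
  "greedy T p y = (if gain T (y(p := 1)) < gain T y then y(p := -1) else y(p := 1))"

definition target_stage :: "nat \<Rightarrow> nat \<Rightarrow> int" where
  "target_stage l = fold (\<lambda>p y. if final m p = 1 then greedy final p y else y) [0..<l] (\<lambda>_. 0)"

definition rest_stage :: "nat \<Rightarrow> nat \<Rightarrow> int" where
  "rest_stage l =
     fold (\<lambda>p y. if final m p = 1 then y else greedy final p y) [0..<l] (target_stage n)"

abbreviation solution :: "nat \<Rightarrow> int" where "solution \<equiv> rest_stage n"

lemma rowprod_upd:
  assumes "p < n"
  shows "rowprod T (y(p := c)) l =
    (if T l p = 1 then c else 1) * (\<Prod>q\<in>{..<n} - {p}. if T l q = 1 then y q else 1)"
proof -
  have "(\<Prod>q\<in>{..<n} - {p}. if T l q = 1 then (y(p := c)) q else 1) =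
      (\<Prod>q\<in>{..<n} - {p}. if T l q = 1 then y q else 1)"
    by (rule prod.cong) auto
  then show ?thesis
    unfolding rowprod_def using assms prod.remove[of "{..<n}" p "\<lambda>q. if T l q = 1 then (y(p := c)) q else 1"]
    by simp
qed

text \<open>The gain is affine in each single variable, so its value at 0 is the mean of its values
  at 1 and -1.\<close>

lemma gain_upd:
  assumes "p < n" "y p = 0"
  shows "gain T (y(p := 1)) + gain T (y(p := -1)) = 2 * gain T y"
proof -
  have "rowprod T (y(p := 1)) l + rowprod T (y(p := -1)) l = 2 * rowprod T y l" for l
  proof -
    have "y = y(p := 0)" using assms(2) by (simp add: fun_upd_idem)
    then have "rowprod T y l = (if T l p = 1 then 0 else 1) * (\<Prod>q\<in>{..<n} - {p}. if T l q = 1 then y q else 1)"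
      using rowprod_upd[OF assms(1), of T y 0 l] by metis
    then show ?thesis using rowprod_upd[OF assms(1), of T y _ l] by simp
  qed
  then have "w l * b l * rowprod T (y(p := 1)) l + w l * b l * rowprod T (y(p := -1)) l = 2 * (w l * b l * rowprod T y l)" for l
    by (metis distrib_left mult.left_commute)
  then show ?thesis unfolding gain_def by (simp add: sum.distrib[symmetric] sum_distrib_left)
qed

lemma gain_greedy: "p < n \<Longrightarrow> y p = 0 \<Longrightarrow> gain T y \<le> gain T (greedy T p y)"
  using gain_upd[of p y T] by (simp add: greedy_def)

text \<open>Setting variable \<open>p\<close> decides exactly one equation, the unit row
  \<open>j\<close> of column \<open>p\<close>. The gain thus changes by
  \<open>w j * b j * s\<close>, and the greedy sign makes this \<open>w j\<close>.\<close>

lemma gain_greedy_target: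
  assumes p: "p < n" "final m p = 1" and y: "y p = 0" "\<And>q. q < n \<Longrightarrow> final m q \<noteq> 1 \<Longrightarrow> y q = 0"
    and w: "\<And>j. j < m \<Longrightarrow> c \<le> w j"
  shows "gain final y + c \<le> gain final (greedy final p y)"
proof -
  obtain j where j: "j < m" "unit final j p" using final_units p by blast
  have row: "rowprod final (y(p := s)) l = rowprod final y l + (if l = j then s else 0)" if l: "l < m" for l s
  proof (cases "l = j")
    case True
    have "rowprod final z j = z p" for z
    proof -
      have "rowprod final z j = (\<Prod>q<n. if q = p then z q else 1)"
        unfolding rowprod_def using j by (intro prod.cong) (auto simp: unit_def)
      then show ?thesis using p by simp
    qed
    then show ?thesis using True y by simp
  next
    case False
    show ?thesis
    proof (cases "final l p = 1")
      case True
      \<comment> \<open>If the support of row \<open>l\<close> lay inside the sum, its balance would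
        be its number of basis elements. Being at most 1, it leaves only \<open>p\<close>, so
        \<open>l\<close> would be a second unit row for column \<open>p\<close>.\<close>
      have "\<exists>q<n. q \<noteq> p \<and> final l q = 1 \<and> final m q \<noteq> 1"
      proof (rule ccontr)
        assume n: "\<not> ?thesis"
        then have e: "val (final l q) * (2 * val (final m q) - 1) = val (final l q)" if "q < n" for q
          using p that by (cases "q = p") auto
        have "balance final l = (\<Sum>q<n. val (final l q))"
          unfolding balance_def by (rule sum.cong[OF refl], rule e, simp)
        also have "\<dots> = 1 + (\<Sum>q\<in>{..<n} - {p}. val (final l q))"
          using p True by (subst sum.remove[of _ p]) auto
        finally have "(\<Sum>q\<in>{..<n} - {p}. val (final l q)) \<le> 0"
          using final_balance[OF l p(1) True p(2)] by simp
        moreover have "0 \<le> (\<Sum>q\<in>{..<n} - {p}. val (final l q))" by (intro sum_nonneg) auto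
        ultimately have "(\<Sum>q\<in>{..<n} - {p}. val (final l q)) = 0" by simp
        then have "\<forall>q\<in>{..<n} - {p}. val (final l q) = 0"
          by (subst (asm) sum_nonneg_eq_0_iff) auto
        then have "unit final l p" using True by (auto simp: unit_def of_bool_def split: if_splits)
        then show False using unit_unique[OF valid_final l j(1) _ j(2)] False by blast
      qed
      then obtain q where q: "q < n" "q \<noteq> p" "final l q = 1" "y q = 0" using y by blast
      then have "rowprod final z l = 0" if "z q = 0" for z
        unfolding rowprod_def using that by (intro prod_zero) auto
      then show ?thesis using q False by simp
    next
      case np: False
      have "rowprod final (y(p := s)) l = rowprod final y l"
        unfolding rowprod_def using np by (intro prod.cong) auto
      then show ?thesis using False by simp
    qed
  qed
  have g: "gain final (y(p := s)) = gain final y + w j * b j * s" for s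
  proof -
    have "gain final (y(p := s)) = (\<Sum>l<m. w l * b l * rowprod final y l + (if l = j then w l * b l * s else 0))"
      unfolding gain_def by (intro sum.cong) (auto simp: row algebra_simps)
    also have "\<dots> = gain final y + w j * b j * s" using j by (simp add: sum.distrib gain_def)
    finally show ?thesis .
  qed
  show ?thesis using g[of 1] g[of "-1"] b_sign[OF j(1)] w_pos[OF j(1)] w[OF j(1)]
    by (auto simp: greedy_def)
qed

lemma greedy_same: "greedy T p y p \<in> {-1, 1}"
  and greedy_other: "q \<noteq> p \<Longrightarrow> greedy T p y q = y q"
  by (auto simp: greedy_def)

text \<open>A nonzero row stays nonzero under the change of basis, so each equation contains some
  new variable, and that variable has value 0.\<close>

lemma gain_zero: "gain final (\<lambda>_. 0) = 0"
proof -
  have "rowprod final (\<lambda>_. 0) j = 0" if j: "j < m" for j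
  proof -
    have "\<exists>q<n. final j q = 1"
    proof (rule ccontr)
      assume "\<not> ?thesis"
      then have "\<forall>q<n. (\<Sum>l\<in>{j}. final l q) = 0" by simp
      then have "\<forall>q<n. (\<Sum>l\<in>{j}. T0 l q) = 0" using valid_relation[OF valid_final] by blast
      then show False using rows_nonzero[OF j] j by (auto simp: T0_def)
    qed
    then show ?thesis unfolding rowprod_def by (intro prod_zero) auto
  qed
  then show ?thesis by (simp add: gain_def)
qed

lemma w_nonneg: "j < m \<Longrightarrow> 0 \<le> w j"
  using w_pos by fastforce

text \<open>The first clause says that variables outside the sum or not yet reached are still 0,
  which is what \<open>gain_greedy_target\<close> requires of the current assignment.\<close>

lemma target_stage:
  assumes w: "\<And>j. j < m \<Longrightarrow> c \<le> w j" and "l \<le> n"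
  shows "(\<forall>q. target_stage l q = 0 \<or> q < l \<and> final m q = 1) \<and>
    (\<forall>q<l. final m q = 1 \<longrightarrow> target_stage l q \<in> {-1, 1}) \<and>
    (\<Sum>q<l. val (final m q)) * c \<le> gain final (target_stage l)"
  using assms(2)
proof (induction l)
  case 0
  then show ?case using gain_zero by (simp add: target_stage_def)
next
  case (Suc l)
  have S: "target_stage (Suc l) = (if final m l = 1 then greedy final l (target_stage l) else target_stage l)" by (simp add: target_stage_def)
  have IH: "\<And>q. target_stage l q = 0 \<or> q < l \<and> final m q = 1" "\<And>q. q < l \<Longrightarrow> final m q = 1 \<Longrightarrow> target_stage l q \<in> {-1, 1}"
    "(\<Sum>q<l. val (final m q)) * c \<le> gain final (target_stage l)" using Suc by auto
  show ?case
  proof (cases "final m l = 1")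
    case True
    have "gain final (target_stage l) + c \<le> gain final (greedy final l (target_stage l))"
    proof (rule gain_greedy_target)
      show "l < n" using Suc.prems by simp
      show "target_stage l l = 0" using IH(1)[of l] by auto
      show "target_stage l q = 0" if "final m q \<noteq> 1" for q using IH(1)[of q] that by auto
    qed (use True w in auto)
    then have "(\<Sum>q<Suc l. val (final m q)) * c \<le> gain final (greedy final l (target_stage l))"
      using IH(3) True by (simp add: algebra_simps)
    moreover have "greedy final l (target_stage l) q = 0 \<or> q < Suc l \<and> final m q = 1" for q
      using greedy_other[where q = q and p = l and T = final and y = "target_stage l"] IH(1)[of q] True by (cases "q = l") auto
    moreover have "greedy final l (target_stage l) q \<in> {-1, 1}" if "q < Suc l" "final m q = 1" for q
      using greedy_same[of final l "target_stage l"] greedy_other[of q l final "target_stage l"] IH(2)[of q] that by (cases "q = l") auto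
    ultimately show ?thesis using S True by auto
  next
    case False
    then show ?thesis using S IH less_Suc_eq by auto
  qed
qed

lemma rest_stage:
  assumes "l \<le> n"
  shows "(\<forall>q. (q < l \<or> final m q = 1) \<and> q < n \<longrightarrow> rest_stage l q \<in> {-1, 1}) \<and>
    (\<forall>q. l \<le> q \<and> final m q \<noteq> 1 \<longrightarrow> rest_stage l q = 0) \<and>
    gain final (target_stage n) \<le> gain final (rest_stage l)"
  using assms
proof (induction l)
  case 0
  \<comment> \<open>Taking \<open>c = 0\<close> suffices here, since only the clauses about the
    values are needed.\<close>
  then show ?case using target_stage[OF w_nonneg, of n] by (auto simp: rest_stage_def)
next
  case (Suc l)
  have S: "rest_stage (Suc l) = (if final m l = 1 then rest_stage l else greedy final l (rest_stage l))" by (simp add: rest_stage_def)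
  show ?case
  proof (cases "final m l = 1")
    case True
    then show ?thesis using S Suc less_Suc_eq by auto
  next
    case False
    have "gain final (rest_stage l) \<le> gain final (greedy final l (rest_stage l))"
      using Suc False by (intro gain_greedy) auto
    moreover have "greedy final l (rest_stage l) q \<in> {-1, 1}" if "q < Suc l \<or> final m q = 1" "q < n" for q
      using greedy_same[of final l "rest_stage l"] greedy_other[of q l final "rest_stage l"] Suc that False by (cases "q = l") (auto simp: less_Suc_eq)
    moreover have "greedy final l (rest_stage l) q = 0" if "Suc l \<le> q" "final m q \<noteq> 1" for q
      using greedy_other[where q = q and p = l and T = final and y = "rest_stage l"] Suc that by auto
    ultimately show ?thesis using S False Suc by auto
  qed
qed

lemma solution_sign: "q < n \<Longrightarrow> solution q \<in> {-1, 1}"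
  using rest_stage[of n] by blast

lemma gain_solution:
  assumes "\<And>j. j < m \<Longrightarrow> c \<le> w j"
  shows "target_size final * c \<le> gain final solution"
  using target_stage[OF assms, of n] rest_stage[of n] by (auto simp: target_size_def)

text \<open>After substituting for each original variable its product of new ones, the factors are
  collected by new variable. The exponent of variable \<open>q\<close> is, modulo 2, the entry of
  \<open>A\<close> times the unit block, and validity identifies it with
  \<open>final j q\<close>.\<close>

lemma rowprod_change_of_variables:
  assumes "j < m"
  shows "(\<Prod>i<n. if A j i = 1 then rowprod final solution (m + 1 + i) else 1) = rowprod final solution j"
proof -
  have s: "solution q \<in> {-1, 1}" if "q < n" for q
    using solution_sign that .
  have "(\<Prod>i<n. if A j i = 1 then rowprod final solution (m + 1 + i) else 1) =
      (\<Prod>i<n. \<Prod>q<n. if A j i * final (m + 1 + i) q = 1 then solution q else 1)"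
    by (intro prod.cong) (auto simp: rowprod_def)
  also have "\<dots> = (\<Prod>q<n. \<Prod>i<n. if A j i * final (m + 1 + i) q = 1 then solution q else 1)"
    by (rule prod.swap)
  also have "\<dots> = (\<Prod>q<n. if (\<Sum>i<n. A j i * final (m + 1 + i) q) = 1 then solution q else 1)"
    using s by (intro prod.cong prod_if_bit_sum) auto
  also have "\<dots> = rowprod final solution j"
  proof -
    have "(\<Sum>i<n. A j i * final (m + 1 + i) q) = final j q" if "q < n" for q
      using valid_row[OF valid_final, of j q] that assms by (simp add: T0_def)
    then show ?thesis unfolding rowprod_def by (intro prod.cong) auto
  qed
  finally show ?thesis .
qed

lemma rowprod_sign: "(\<And>q. q < n \<Longrightarrow> y q \<in> {-1, 1}) \<Longrightarrow> rowprod T y l \<in> {-1, 1}"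
  unfolding rowprod_def
proof -
  assume y: "\<And>q. q < n \<Longrightarrow> y q \<in> {-1, 1}"
  have "(\<Prod>q<k. if T l q = 1 then y q else 1) \<in> {-1, 1}" if "k \<le> n" for k
    using that
  proof (induction k)
    case (Suc k)
    then show ?case using y[of k] by auto
  qed simp
  then show "(\<Prod>q<n. if T l q = 1 then y q else 1) \<in> {-1, 1}" by blast
qed

end

section \<open>The program\<close>

text \<open>
  The tableau is kept in the array \<open>A\<close>; as multiplication is not primitive, the array \<open>R\<close> holds the
  addresses of its rows.
\<close>

abbreviation Pos :: "aexp \<Rightarrow> bexp" where "Pos e \<equiv> Less (Const 0) e"

definition Cell :: "string \<Rightarrow> string \<Rightarrow> aexp" where
  "Cell l q = Read ''A'' (Add (Read ''R'' (V l)) (V q))"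

text \<open>The added rows occupy cells that are 0 in the input, so only their ones are written.
  \<open>h\<close> runs through the multiples of \<open>n\<close>, starting from an untouched
  0.\<close>

definition setup_com :: com where
  "setup_com =
     Seq (Set ''N'' (Add (Add (V ''n'') (V ''m'')) (Const 1)))
    (Seq (For ''l'' ''N'' (Seq (Assign ''R'' (V ''l'') (V ''h'')) (Set ''h'' (Add (V ''h'') (V ''n'')))))
      (For ''q'' ''n'' (Seq
         (Assign ''A'' (Add (Read ''R'' (V ''m'')) (V ''q'')) (Const 1))
         (Assign ''A'' (Add (Read ''R'' (Add (V ''m'') (Add (V ''q'') (Const 1)))) (V ''q'')) (Const 1)))))"

text \<open>Working in place is safe: column \<open>p\<close> is skipped and never written, and the
  entry in row \<open>j\<close> of column \<open>q\<close> is read before that column changes.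
  Subtracting an entry from 1 is addition of 1 over \<open>bit\<close>.\<close>

definition pivot_com :: com where
  "pivot_com =
     For ''q'' ''n'' (Cond
       (Conj (Neg (Conj (Neg (Less (V ''q'') (V ''p''))) (Neg (Less (V ''p'') (V ''q'')))))
             (Pos (Cell ''j'' ''q'')))
       (For ''l'' ''N'' (Cond (Pos (Cell ''l'' ''p''))
          (Assign ''A'' (Add (Read ''R'' (V ''l'')) (V ''q'')) (Sub (Const 1) (Cell ''l'' ''q''))) Skip))
       Skip)"

definition sweep_com :: "com \<Rightarrow> com" where
  "sweep_com test =
     For ''p'' ''n'' (For ''j'' ''m'' (Seq test
       (Cond (Conj (Pos (Cell ''j'' ''p'')) (Less (Const 1) (V ''v''))) pivot_com Skip)))"

text \<open>A test reports through \<open>v\<close>, where a value above 1 means acceptance. The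
  constant 2 always accepts, while \<open>shrinks_com\<close> can leave the balance itself there, or
  0 when \<open>p\<close> is outside the sum.\<close>

definition all_com :: com where
  "all_com = Set ''v'' (Const 2)"

definition shrinks_com :: com where
  "shrinks_com =
     Seq (Set ''v'' (Const 0)) (Cond (Pos (Cell ''m'' ''p''))
       (For ''q'' ''n'' (Cond (Pos (Cell ''m'' ''q''))
          (Set ''v'' (Add (V ''v'') (Cell ''j'' ''q'')))
          (Set ''v'' (Sub (V ''v'') (Cell ''j'' ''q'')))))
       Skip)"

definition tableau_com :: com where
  "tableau_com = Seq (sweep_com all_com) (For ''i'' ''n'' (sweep_com shrinks_com))"

text \<open>Multiplication by a value in \<open>{-1, 0, 1}\<close> is negation, clearing or nothing.
  The factor initially in \<open>z\<close> is kept, so starting from the signed weight yields a term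
  of the gain, and starting from 1 yields the bare product.\<close>

definition rowprod_com :: "string \<Rightarrow> com" where
  "rowprod_com l =
     For ''q'' ''n'' (Cond (Pos (Cell l ''q''))
       (Cond (Less (Read ''y'' (V ''q'')) (Const 0)) (Set ''z'' (Sub (Const 0) (V ''z'')))
         (Cond (Less (Read ''y'' (V ''q'')) (Const 1)) (Set ''z'' (Const 0)) Skip))
       Skip)"

definition gain_com :: com where
  "gain_com =
     Seq (Set ''g'' (Const 0)) (For ''j'' ''m'' (Seq
       (Cond (Less (Read ''b'' (V ''j'')) (Const 0))
         (Set ''z'' (Sub (Const 0) (Read ''w'' (V ''j'')))) (Set ''z'' (Read ''w'' (V ''j''))))
       (Seq (rowprod_com ''j'') (Set ''g'' (Add (V ''g'') (V ''z''))))))"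

text \<open>\<open>e\<close> caches the gain of the current assignment. When -1 is chosen,
  \<open>gain_upd\<close> gives the new gain as \<open>e + e - g\<close>, without another
  evaluation.\<close>

definition greedy_com :: com where
  "greedy_com =
     Seq (Assign ''y'' (V ''p'') (Const 1)) (Seq gain_com
       (Cond (Less (V ''g'') (V ''e''))
         (Seq (Assign ''y'' (V ''p'') (Const (-1))) (Set ''e'' (Sub (Add (V ''e'') (V ''e'')) (V ''g''))))
         (Set ''e'' (V ''g''))))"

definition solution_com :: com where
  "solution_com =
     Seq (For ''p'' ''n'' (Cond (Pos (Cell ''m'' ''p'')) greedy_com Skip))
         (For ''p'' ''n'' (Cond (Pos (Cell ''m'' ''p'')) Skip greedy_com))"

definition output_com :: com where
  "output_com =
     For ''i'' ''n'' (Seq (Set ''l'' (Add (Add (V ''m'') (V ''i'')) (Const 1)))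
       (Seq (Set ''z'' (Const 1)) (Seq (rowprod_com ''l'') (Assign ''x'' (V ''i'') (V ''z'')))))"

definition maxlin_com :: com where
  "maxlin_com = Seq setup_com (Seq tableau_com (Seq solution_com output_com))"

lemma writes_program [simp]:
  "writes setup_com = {''N'', ''l'', ''R'', ''h'', ''q'', ''A''}"
  "writes pivot_com = {''q'', ''l'', ''A''}"
  "writes (sweep_com test) = {''p'', ''j'', ''q'', ''l'', ''A''} \<union> writes test"
  "writes all_com = {''v''}"
  "writes shrinks_com = {''v'', ''q''}"
  "writes tableau_com = {''i'', ''p'', ''j'', ''q'', ''l'', ''A'', ''v''}"
  "writes (rowprod_com r) = {''q'', ''z''}"
  "writes gain_com = {''g'', ''j'', ''z'', ''q''}"
  "writes greedy_com = {''y'', ''g'', ''j'', ''z'', ''q'', ''e''}"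
  "writes solution_com = {''p'', ''y'', ''g'', ''j'', ''z'', ''q'', ''e''}"
  by (auto simp: setup_com_def pivot_com_def sweep_com_def all_com_def shrinks_com_def tableau_com_def
      rowprod_com_def gain_com_def greedy_com_def solution_com_def)

lemma row_major_eq_iff:
  fixes l l' q q' n :: nat
  assumes "q < n" "q' < n"
  shows "int l * int n + int q = int l' * int n + int q' \<longleftrightarrow> l = l' \<and> q = q'"
proof
  assume "int l * int n + int q = int l' * int n + int q'"
  then have e: "l * n + q = l' * n + q'" by (metis of_nat_add of_nat_eq_iff of_nat_mult)
  have "l = (l * n + q) div n" "q = (l * n + q) mod n" using assms by simp_all
  moreover have "l' = (l' * n + q') div n" "q' = (l' * n + q') mod n" using assms by simp_all
  ultimately show "l = l' \<and> q = q'" using e by metis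
qed simp

section \<open>Correctness and running time of the program\<close>

context maxlin
begin

text \<open>The longest loops run over all \<open>m + n + 1\<close> rows of the tableau, and
  \<open>achieves_For\<close> asks for three times that number plus 2.\<close>

abbreviation K :: nat where "K \<equiv> 3 * (m + n + 1) + 2"

definition stored :: "tableau \<Rightarrow> store \<Rightarrow> bool" where
  "stored T s \<longleftrightarrow> s ''n'' 0 = int n \<and> s ''m'' 0 = int m \<and> s ''N'' 0 = int (m + n + 1) \<and>
     (\<forall>l\<le>m + n. s ''R'' (int l) = int l * int n) \<and>
     (\<forall>l\<le>m + n. \<forall>q<n. s ''A'' (int l * int n + int q) = val (T l q)) \<and>
     (\<forall>j<m. s ''b'' (int j) = b j \<and> s ''w'' (int j) = w j)"

lemma stored_frame:
  assumes "stored T s" "s' ''n'' = s ''n''" "s' ''m'' = s ''m''" "s' ''N'' = s ''N''" "s' ''R'' = s ''R''"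
    "s' ''A'' = s ''A''" "s' ''b'' = s ''b''" "s' ''w'' = s ''w''"
  shows "stored T s'"
  using assms by (simp add: stored_def)

lemma stored_cong:
  "stored T s \<Longrightarrow> (\<And>l q. l \<le> m + n \<Longrightarrow> q < n \<Longrightarrow> T l q = T' l q) \<Longrightarrow> stored T' s"
  by (simp add: stored_def)

lemma stored_update:
  assumes "stored T s" "l \<le> m + n" "q < n"
  shows "stored (\<lambda>l' q'. if l' = l \<and> q' = q then a else T l' q')
    (s(''A'' := (s ''A'')(int l * int n + int q := val a)))"
  using assms by (auto simp: stored_def row_major_eq_iff)

lemma stored_update_var:
  assumes "a \<notin> {''n'', ''m'', ''N'', ''R'', ''A'', ''b'', ''w''}"
  shows "stored T (s(a := f)) = stored T s"
proof
  assume "stored T (s(a := f))"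
  then show "stored T s" by (rule stored_frame) (use assms in auto)
next
  assume "stored T s"
  then show "stored T (s(a := f))" by (rule stored_frame) (use assms in auto)
qed

lemma aval_Cell:
  "stored T s \<Longrightarrow> s r 0 = int l \<Longrightarrow> s c 0 = int q \<Longrightarrow> l \<le> m + n \<Longrightarrow> q < n \<Longrightarrow>
    aval (Cell r c) s = val (T l q)"
  by (simp add: stored_def Cell_def)

lemma stored_scalars:
  assumes "stored T s"
  shows "s ''n'' 0 = int n" "s ''m'' 0 = int m" "s ''N'' 0 = int (m + n + 1)"
    "l \<le> m + n \<Longrightarrow> s ''R'' (int l) = int l * int n"
    "j < m \<Longrightarrow> s ''b'' (int j) = b j" "j < m \<Longrightarrow> s ''w'' (int j) = w j"
  using assms by (simp_all add: stored_def)

lemma achieves_pivot: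
  assumes T: "stored T s" and j: "s ''j'' 0 = int j" "j < m" and p: "s ''p'' 0 = int p" "p < n"
  shows "achieves K pivot_com 4 (stored (pivot T j p)) s"
  unfolding pivot_com_def
proof (rule achieves_For[where L = n and j = 3
      and I = "\<lambda>k. stored (\<lambda>l q. if q < k then pivot T j p l q else T l q)"])
  show "s ''n'' 0 = int n" using T by (rule stored_scalars)
  show "stored (\<lambda>l q. if q < 0 then pivot T j p l q else T l q) (s(''q'' := (s ''q'')(0 := 0)))"
    using T by (simp add: stored_update_var)
  fix s' assume "stored (\<lambda>l q. if q < n then pivot T j p l q else T l q) s'"
  then show "stored (pivot T j p) s'" by (rule stored_cong) simp
next
  fix k s'
  assume k: "k < n" "s' ''q'' 0 = int k" and T': "stored (\<lambda>l q. if q < k then pivot T j p l q else T l q) s'"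
    and F: "\<forall>a. a \<notin> insert ''q'' (writes (Cond
       (Conj (Neg (Conj (Neg (Less (V ''q'') (V ''p''))) (Neg (Less (V ''p'') (V ''q'')))))
             (Pos (Cell ''j'' ''q'')))
       (For ''l'' ''N'' (Cond (Pos (Cell ''l'' ''p''))
          (Assign ''A'' (Add (Read ''R'' (V ''l'')) (V ''q'')) (Sub (Const 1) (Cell ''l'' ''q''))) Skip))
       Skip)) \<longrightarrow> s' a = s a"
  let ?S = "\<lambda>l q. if q < k then pivot T j p l q else T l q"
  let ?S' = "\<lambda>l q. if q < Suc k then pivot T j p l q else T l q"
  let ?post = "\<lambda>s''. stored ?S' (s''(''q'' := (s'' ''q'')(0 := int (Suc k))))"
  have jp: "s' ''j'' 0 = int j" "s' ''p'' 0 = int p" using F j p by simp_all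
  have cell: "aval (Cell ''j'' ''q'') s' = val (T j k)"
    using aval_Cell[OF T' jp(1) k(2)] j k by simp
  show "achieves K (Cond
       (Conj (Neg (Conj (Neg (Less (V ''q'') (V ''p''))) (Neg (Less (V ''p'') (V ''q'')))))
             (Pos (Cell ''j'' ''q'')))
       (For ''l'' ''N'' (Cond (Pos (Cell ''l'' ''p''))
          (Assign ''A'' (Add (Read ''R'' (V ''l'')) (V ''q'')) (Sub (Const 1) (Cell ''l'' ''q''))) Skip))
       Skip) 3 ?post s'"
  proof (rule achieves_Cond[where i = 2])
    assume "\<not> bval (Conj (Neg (Conj (Neg (Less (V ''q'') (V ''p''))) (Neg (Less (V ''p'') (V ''q'')))))
             (Pos (Cell ''j'' ''q''))) s'"
    then have "k = p \<or> T j k = 0" using jp k cell by auto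
    then have "stored ?S' s'" using T' by (auto elim!: stored_cong simp: pivot_def less_Suc_eq)
    then show "achieves K Skip 2 ?post s'" by (intro achieves_Skip) (simp_all add: stored_update_var)
  next
    assume "bval (Conj (Neg (Conj (Neg (Less (V ''q'') (V ''p''))) (Neg (Less (V ''p'') (V ''q'')))))
             (Pos (Cell ''j'' ''q''))) s'"
    then have kp: "k \<noteq> p" "T j k = 1" using jp k cell by auto
    \<comment> \<open>The intermediate tableau has column \<open>k\<close> updated in the rows below
      \<open>i\<close>. Column \<open>p\<close> is the same in all intermediate tableaux, so the
      entries read are those of \<open>T\<close>.\<close>
    let ?I = "\<lambda>i l q. if q = k \<and> l < i then pivot T j p l q else ?S l q"
    show "achieves K (For ''l'' ''N'' (Cond (Pos (Cell ''l'' ''p''))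
          (Assign ''A'' (Add (Read ''R'' (V ''l'')) (V ''q'')) (Sub (Const 1) (Cell ''l'' ''q''))) Skip)) 2 ?post s'"
    proof (rule achieves_For[where L = "m + n + 1" and j = 1 and I = "\<lambda>i. stored (?I i)"])
      show "s' ''N'' 0 = int (m + n + 1)" using T' by (rule stored_scalars)
      show "stored (?I 0) (s'(''l'' := (s' ''l'')(0 := 0)))" using T' by (simp add: stored_update_var)
      fix s'' assume "stored (?I (m + n + 1)) s''"
      then have "stored ?S' s''" by (rule stored_cong) (simp add: less_Suc_eq)
      then show "?post s''" by (simp add: stored_update_var)
    next
      fix i t
      assume i: "i < m + n + 1" "t ''l'' 0 = int i" and It: "stored (?I i) t"
        and Ft: "\<forall>a. a \<notin> insert ''l'' (writes (Cond (Pos (Cell ''l'' ''p''))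
          (Assign ''A'' (Add (Read ''R'' (V ''l'')) (V ''q'')) (Sub (Const 1) (Cell ''l'' ''q''))) Skip)) \<longrightarrow> t a = s' a"
      have pq: "t ''p'' 0 = int p" "t ''q'' 0 = int k" using Ft jp k by simp_all
      have c: "aval (Cell ''l'' ''p'') t = val (T i p)" "aval (Cell ''l'' ''q'') t = val (T i k)"
        using aval_Cell[OF It i(2) pq(1)] aval_Cell[OF It i(2) pq(2)] i k p kp by (auto simp: pivot_def)
      show "achieves K (Cond (Pos (Cell ''l'' ''p''))
          (Assign ''A'' (Add (Read ''R'' (V ''l'')) (V ''q'')) (Sub (Const 1) (Cell ''l'' ''q''))) Skip) 1
          (\<lambda>u. stored (?I (Suc i)) (u(''l'' := (u ''l'')(0 := int (Suc i))))) t"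
      proof (rule achieves_Cond[where i = 0])
        assume "bval (Pos (Cell ''l'' ''p'')) t"
        then have ip: "T i p = 1" using c by simp
        have R: "t ''R'' (int i) = int i * int n" using stored_scalars(4)[OF It] i by simp
        have "1 - val (T i k) = val (T i k + 1)" by (cases "T i k") auto
        moreover have "stored (?I (Suc i)) (t(''A'' := (t ''A'')(int i * int n + int k := val (T i k + 1))))"
        proof (rule stored_cong[OF stored_update[OF It]])
          show "i \<le> m + n" "k < n" using i k by simp_all
          show "(if l = i \<and> q = k then T i k + 1 else ?I i l q) = ?I (Suc i) l q" for l q
            using ip kp by (auto simp: pivot_def less_Suc_eq)
        qed
        ultimately show "achieves K (Assign ''A'' (Add (Read ''R'' (V ''l'')) (V ''q'')) (Sub (Const 1) (Cell ''l'' ''q''))) 0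
            (\<lambda>u. stored (?I (Suc i)) (u(''l'' := (u ''l'')(0 := int (Suc i))))) t"
          using i pq c R by (intro achieves_Assign) (simp_all add: stored_update_var)
      next
        assume "\<not> bval (Pos (Cell ''l'' ''p'')) t"
        then have ip: "T i p = 0" using c by simp
        have "stored (?I (Suc i)) t" using It by (auto elim!: stored_cong simp: pivot_def ip less_Suc_eq)
        then show "achieves K Skip 0 (\<lambda>u. stored (?I (Suc i)) (u(''l'' := (u ''l'')(0 := int (Suc i))))) t"
          by (intro achieves_Skip) (simp_all add: stored_update_var)
      qed simp_all
    qed simp_all
  qed simp_all
qed simp_all

text \<open>Allowing the test to write only \<open>v\<close> and \<open>q\<close> protects the
  tableau and both loop counters.\<close>

lemma achieves_sweep:
  assumes T: "stored T s"
    and test: "\<And>T s j p. stored T s \<Longrightarrow> s ''j'' 0 = int j \<Longrightarrow> s ''p'' 0 = int p \<Longrightarrow> j < m \<Longrightarrow> p < n \<Longrightarrow>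
      achieves K test 4 (\<lambda>s'. 1 < s' ''v'' 0 \<longleftrightarrow> C T j p) s"
    and w: "writes test \<subseteq> {''v'', ''q''}"
  shows "achieves K (sweep_com test) 8 (stored (sweep n m C T)) s"
proof -
  let ?g = "\<lambda>p j T. if T j p = 1 \<and> C T j p then pivot T j p else T"
  let ?row = "Seq test (Cond (Conj (Pos (Cell ''j'' ''p'')) (Less (Const 1) (V ''v''))) pivot_com Skip)"
  have fresh: "a \<notin> writes test" if "a \<notin> {''v'', ''q''}" for a using w that by blast
  have body: "achieves K ?row 6 (stored (?g p j T)) s"
    if T: "stored T s" and j: "s ''j'' 0 = int j" "j < m" and p: "s ''p'' 0 = int p" "p < n" for T s j p
  proof (rule achieves_Seq[OF test[OF T j(1) p(1) j(2) p(2)], where j = 5])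
    fix s' assume v: "1 < s' ''v'' 0 \<longleftrightarrow> C T j p" and F: "\<forall>a. a \<notin> writes test \<longrightarrow> s' a = s a"
    have T': "stored T s'" using T by (rule stored_frame) (use F fresh in simp_all)
    have jp: "s' ''j'' 0 = int j" "s' ''p'' 0 = int p" using F fresh j p by auto
    have c: "aval (Cell ''j'' ''p'') s' = val (T j p)" using aval_Cell[OF T' jp] j p by simp
    show "achieves K (Cond (Conj (Pos (Cell ''j'' ''p'')) (Less (Const 1) (V ''v''))) pivot_com Skip) 5
        (stored (?g p j T)) s'"
    proof (rule achieves_Cond[where i = 4])
      assume "bval (Conj (Pos (Cell ''j'' ''p'')) (Less (Const 1) (V ''v''))) s'"
      then have "?g p j T = pivot T j p" using c v by simp
      then show "achieves K pivot_com 4 (stored (?g p j T)) s'"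
        using achieves_pivot[OF T' jp(1) j(2) jp(2) p(2)] by simp
    next
      assume "\<not> bval (Conj (Pos (Cell ''j'' ''p'')) (Less (Const 1) (V ''v''))) s'"
      then have "?g p j T = T" using c v by auto
      then show "achieves K Skip 4 (stored (?g p j T)) s'" using T' by (intro achieves_Skip) simp_all
    qed simp_all
  qed simp_all
  have col: "achieves K (For ''j'' ''m'' ?row) 7 (stored (fold (?g p) [0..<m] T)) s"
    if T: "stored T s" and p: "s ''p'' 0 = int p" "p < n" for T s p
  proof (rule achieves_For[where L = m and j = 6 and I = "\<lambda>k. stored (fold (?g p) [0..<k] T)"])
    show "s ''m'' 0 = int m" using T by (rule stored_scalars)
    show "stored (fold (?g p) [0..<0] T) (s(''j'' := (s ''j'')(0 := 0)))" using T by (simp add: stored_update_var)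
    fix k s' assume k: "k < m" "stored (fold (?g p) [0..<k] T) s'" "s' ''j'' 0 = int k"
      and F: "\<forall>a. a \<notin> insert ''j'' (writes ?row) \<longrightarrow> s' a = s a"
    have "s' ''p'' 0 = int p" using F p fresh by simp
    from body[OF k(2,3,1) this p(2)]
    show "achieves K ?row 6 (\<lambda>s''. stored (fold (?g p) [0..<Suc k] T) (s''(''j'' := (s'' ''j'')(0 := int (Suc k))))) s'"
      by (rule achieves_mono) (simp_all add: stored_update_var)
  qed (use fresh in simp_all)
  show ?thesis
    unfolding sweep_com_def
  proof (rule achieves_For[where L = n and j = 7 and I = "\<lambda>k. stored (fold (\<lambda>p. fold (?g p) [0..<m]) [0..<k] T)"])
    show "s ''n'' 0 = int n" using T by (rule stored_scalars)
    show "stored (fold (\<lambda>p. fold (?g p) [0..<m]) [0..<0] T) (s(''p'' := (s ''p'')(0 := 0)))"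
      using T by (simp add: stored_update_var)
    fix k s' assume k: "k < n" "stored (fold (\<lambda>p. fold (?g p) [0..<m]) [0..<k] T) s'" "s' ''p'' 0 = int k"
    from col[OF k(2,3,1)]
    show "achieves K (For ''j'' ''m'' ?row) 7 (\<lambda>s''. stored (fold (\<lambda>p. fold (?g p) [0..<m]) [0..<Suc k] T)
        (s''(''p'' := (s'' ''p'')(0 := int (Suc k))))) s'"
      by (rule achieves_mono) (simp_all add: stored_update_var)
  next
    fix s' assume "stored (fold (\<lambda>p. fold (?g p) [0..<m]) [0..<n] T) s'"
    then show "stored (sweep n m C T) s'" by (simp add: sweep_def)
  qed (use fresh in simp_all)
qed

lemma achieves_shrinks:
  assumes T: "stored T s" and j: "s ''j'' 0 = int j" "j < m" and p: "s ''p'' 0 = int p" "p < n"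
  shows "achieves K shrinks_com 4 (\<lambda>s'. 1 < s' ''v'' 0 \<longleftrightarrow> shrinks T j p) s"
  unfolding shrinks_com_def
proof (rule achieves_Seq[where i = 0 and j = 3])
  let ?c = "Cond (Pos (Cell ''m'' ''q''))
          (Set ''v'' (Add (V ''v'') (Cell ''j'' ''q'')))
          (Set ''v'' (Sub (V ''v'') (Cell ''j'' ''q'')))"
  show "achieves K (Set ''v'' (Const 0)) 0 (\<lambda>s'. s' ''v'' 0 = 0) s" by (rule achieves_Assign) simp_all
  fix s' assume v: "s' ''v'' 0 = 0" and F: "\<forall>a. a \<notin> writes (Set ''v'' (Const 0)) \<longrightarrow> s' a = s a"
  have T': "stored T s'" using T by (rule stored_frame) (use F in simp_all)
  have jp: "s' ''j'' 0 = int j" "s' ''p'' 0 = int p" using F j p by auto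
  note sc = stored_scalars[OF T']
  have c: "aval (Cell ''m'' ''p'') s' = val (T m p)" using aval_Cell[OF T' sc(2) jp(2)] p by simp
  show "achieves K (Cond (Pos (Cell ''m'' ''p'')) (For ''q'' ''n'' ?c) Skip) 3 (\<lambda>s'. 1 < s' ''v'' 0 \<longleftrightarrow> shrinks T j p) s'"
  proof (rule achieves_Cond[where i = 2])
    assume "\<not> bval (Pos (Cell ''m'' ''p'')) s'"
    then show "achieves K Skip 2 (\<lambda>s'. 1 < s' ''v'' 0 \<longleftrightarrow> shrinks T j p) s'"
      using c v by (intro achieves_Skip) (simp_all add: shrinks_def)
  next
    assume "bval (Pos (Cell ''m'' ''p'')) s'"
    then have mp: "T m p = 1" using c by simp
    show "achieves K (For ''q'' ''n'' ?c) 2 (\<lambda>s'. 1 < s' ''v'' 0 \<longleftrightarrow> shrinks T j p) s'"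
    proof (rule achieves_For[where L = n and j = 1 and
          I = "\<lambda>k s. s ''v'' 0 = (\<Sum>q<k. val (T j q) * (2 * val (T m q) - 1))"])
      show "s' ''n'' 0 = int n" by (rule sc)
      fix k t assume k: "k < n" "t ''q'' 0 = int k" and I: "t ''v'' 0 = (\<Sum>q<k. val (T j q) * (2 * val (T m q) - 1))"
        and Ft: "\<forall>a. a \<notin> insert ''q'' (writes ?c) \<longrightarrow> t a = s' a"
      have Tt: "stored T t" using T' by (rule stored_frame) (use Ft in simp_all)
      have jt: "t ''j'' 0 = int j" using Ft jp by auto
      have "aval (Cell ''m'' ''q'') t = val (T m k)" "aval (Cell ''j'' ''q'') t = val (T j k)"
        using aval_Cell[OF Tt stored_scalars(2)[OF Tt] k(2)] aval_Cell[OF Tt jt k(2)] k j by simp_all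
      then show "achieves K ?c 1 (\<lambda>s. (s(''q'' := (s ''q'')(0 := int (Suc k)))) ''v'' 0 =
          (\<Sum>q<Suc k. val (T j q) * (2 * val (T m q) - 1))) t"
        using I by (intro achieves_Cond[where i = 0] achieves_Assign) simp_all
    qed (use v mp in \<open>simp_all add: shrinks_def balance_def\<close>)
  qed simp_all
qed simp_all

lemma achieves_tableau:
  assumes "stored T0 s"
  shows "achieves K tableau_com 10 (stored final) s"
  unfolding tableau_com_def
proof (rule achieves_Seq[where i = 8 and j = 9])
  show "achieves K (sweep_com all_com) 8 (stored (sweep n m (\<lambda>_ _ _. True) T0)) s"
    using assms by (rule achieves_sweep) (simp_all add: all_com_def achieves_Assign)
  fix s' assume s': "stored (sweep n m (\<lambda>_ _ _. True) T0) s'"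
  let ?F = "\<lambda>k. fold (\<lambda>_. sweep n m shrinks) [0..<k] (sweep n m (\<lambda>_ _ _. True) T0)"
  show "achieves K (For ''i'' ''n'' (sweep_com shrinks_com)) 9 (stored final) s'"
  proof (rule achieves_For[where L = n and j = 8 and I = "\<lambda>k. stored (?F k)"])
    show "s' ''n'' 0 = int n" using s' by (rule stored_scalars)
    show "stored (?F 0) (s'(''i'' := (s' ''i'')(0 := 0)))" using s' by (simp add: stored_update_var)
    fix k t assume "stored (?F k) t"
    then have "achieves K (sweep_com shrinks_com) 8 (stored (sweep n m shrinks (?F k))) t"
    proof (rule achieves_sweep)
      show "achieves K shrinks_com 4 (\<lambda>s'. 1 < s' ''v'' 0 \<longleftrightarrow> shrinks T j p) s"
        if "stored T s" "s ''j'' 0 = int j" "s ''p'' 0 = int p" "j < m" "p < n" for T s j p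
        using that(1,2,4,3,5) by (rule achieves_shrinks)
    qed simp
    then show "achieves K (sweep_com shrinks_com) 8 (\<lambda>t. stored (?F (Suc k)) (t(''i'' := (t ''i'')(0 := int (Suc k))))) t"
      by (rule achieves_mono) (simp_all add: stored_update_var)
  qed (simp_all add: final_def)
qed simp_all

text \<open>The restriction to three values matches the case distinction of
  \<open>rowprod_com\<close>.\<close>

definition assigned :: "(nat \<Rightarrow> int) \<Rightarrow> store \<Rightarrow> bool" where
  "assigned Y s \<longleftrightarrow> (\<forall>q<n. s ''y'' (int q) = Y q \<and> Y q \<in> {-1, 0, 1})"

lemma assigned_frame: "assigned Y s \<Longrightarrow> s' ''y'' = s ''y'' \<Longrightarrow> assigned Y s'"
  by (simp add: assigned_def)

lemma achieves_rowprod: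
  assumes T: "stored T s" and Y: "assigned Y s" and r: "s r 0 = int l" "l \<le> m + n" "r \<notin> {''q'', ''z''}"
  shows "achieves K (rowprod_com r) 4 (\<lambda>s'. s' ''z'' 0 = s ''z'' 0 * rowprod T Y l) s"
  unfolding rowprod_com_def
proof (rule achieves_For[where L = n and j = 3 and
      I = "\<lambda>k s'. s' ''z'' 0 = s ''z'' 0 * (\<Prod>q<k. if T l q = 1 then Y q else 1)"])
  let ?c = "Cond (Pos (Cell r ''q''))
       (Cond (Less (Read ''y'' (V ''q'')) (Const 0)) (Set ''z'' (Sub (Const 0) (V ''z'')))
         (Cond (Less (Read ''y'' (V ''q'')) (Const 1)) (Set ''z'' (Const 0)) Skip))
       Skip"
  show "s ''n'' 0 = int n" using T by (rule stored_scalars)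
  fix k t assume k: "k < n" "t ''q'' 0 = int k"
    and I: "t ''z'' 0 = s ''z'' 0 * (\<Prod>q<k. if T l q = 1 then Y q else 1)"
    and F: "\<forall>a. a \<notin> insert ''q'' (writes ?c) \<longrightarrow> t a = s a"
  have Tt: "stored T t" using T by (rule stored_frame) (use F in simp_all)
  have rt: "t r 0 = int l" using F r by auto
  have c: "aval (Cell r ''q'') t = val (T l k)" using aval_Cell[OF Tt rt k(2)] k r by simp
  have y: "t ''y'' (int k) = Y k" "Y k \<in> {-1, 0, 1}" using F Y k by (auto simp: assigned_def)
  show "achieves K ?c 3 (\<lambda>s'. (s'(''q'' := (s' ''q'')(0 := int (Suc k)))) ''z'' 0 =
      s ''z'' 0 * (\<Prod>q<Suc k. if T l q = 1 then Y q else 1)) t"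
    by (intro achieves_Cond[where i = 2 and d = 3] achieves_Cond[where i = 1 and d = 2]
        achieves_Cond[where i = 0 and d = 1] achieves_Assign achieves_Skip)
      (use c y I k in auto)
qed (simp_all add: rowprod_def)

lemma achieves_gain:
  assumes T: "stored T s" and Y: "assigned Y s"
  shows "achieves K gain_com 8 (\<lambda>s'. s' ''g'' 0 = gain T Y) s"
  unfolding gain_com_def
proof (rule achieves_Seq[where i = 0 and j = 7])
  let ?a = "Cond (Less (Read ''b'' (V ''j'')) (Const 0))
         (Set ''z'' (Sub (Const 0) (Read ''w'' (V ''j'')))) (Set ''z'' (Read ''w'' (V ''j'')))"
  let ?b = "Seq (rowprod_com ''j'') (Set ''g'' (Add (V ''g'') (V ''z'')))"
  show "achieves K (Set ''g'' (Const 0)) 0 (\<lambda>s'. s' ''g'' 0 = 0) s" by (rule achieves_Assign) simp_all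
  fix s' assume g: "s' ''g'' 0 = 0" and F: "\<forall>a. a \<notin> writes (Set ''g'' (Const 0)) \<longrightarrow> s' a = s a"
  have T': "stored T s'" using T by (rule stored_frame) (use F in simp_all)
  have Y': "assigned Y s'" using Y by (rule assigned_frame) (use F in simp)
  show "achieves K (For ''j'' ''m'' (Seq ?a ?b)) 7 (\<lambda>s'. s' ''g'' 0 = gain T Y) s'"
  proof (rule achieves_For[where L = m and j = 6 and
        I = "\<lambda>k s. s ''g'' 0 = (\<Sum>j<k. w j * b j * rowprod T Y j)"])
    show "s' ''m'' 0 = int m" using T' by (rule stored_scalars)
    fix k t assume k: "k < m" "t ''j'' 0 = int k" and I: "t ''g'' 0 = (\<Sum>j<k. w j * b j * rowprod T Y j)"
      and Ft: "\<forall>a. a \<notin> insert ''j'' (writes (Seq ?a ?b)) \<longrightarrow> t a = s' a"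
    have Tt: "stored T t" using T' by (rule stored_frame) (use Ft in simp_all)
    have Yt: "assigned Y t" using Y' by (rule assigned_frame) (use Ft in simp)
    show "achieves K (Seq ?a ?b) 6 (\<lambda>s. (s(''j'' := (s ''j'')(0 := int (Suc k)))) ''g'' 0 =
        (\<Sum>j<Suc k. w j * b j * rowprod T Y j)) t"
    proof (rule achieves_Seq[where i = 1 and j = 5])
      show "achieves K ?a 1 (\<lambda>u. u ''z'' 0 = w k * b k) t"
        using b_sign[OF k(1)] stored_scalars(5,6)[OF Tt k(1)] k(2)
        by (intro achieves_Cond[where i = 0] achieves_Assign) auto
      fix u assume z: "u ''z'' 0 = w k * b k" and Fu: "\<forall>a. a \<notin> writes ?a \<longrightarrow> u a = t a"
      have Tu: "stored T u" using Tt by (rule stored_frame) (use Fu in simp_all)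
      have Yu: "assigned Y u" using Yt by (rule assigned_frame) (use Fu in simp)
      have ju: "u ''j'' 0 = int k" "u ''g'' 0 = t ''g'' 0" using Fu k by auto
      show "achieves K ?b 5 (\<lambda>s. (s(''j'' := (s ''j'')(0 := int (Suc k)))) ''g'' 0 =
        (\<Sum>j<Suc k. w j * b j * rowprod T Y j)) u"
      proof (rule achieves_Seq[where i = 4 and j = 0])
        show "achieves K (rowprod_com ''j'') 4 (\<lambda>v. v ''z'' 0 = u ''z'' 0 * rowprod T Y k) u"
          using Tu Yu ju(1) by (rule achieves_rowprod) (use k in simp_all)
        fix v assume "v ''z'' 0 = u ''z'' 0 * rowprod T Y k"
          and "\<forall>a. a \<notin> writes (rowprod_com ''j'') \<longrightarrow> v a = u a"
        then show "achieves K (Set ''g'' (Add (V ''g'') (V ''z''))) 0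
            (\<lambda>s. (s(''j'' := (s ''j'')(0 := int (Suc k)))) ''g'' 0 = (\<Sum>j<Suc k. w j * b j * rowprod T Y j)) v"
          using z ju I by (intro achieves_Assign) simp_all
      qed simp_all
    qed simp_all
  qed (use g in \<open>simp_all add: gain_def\<close>)
qed simp_all

lemma achieves_greedy:
  assumes T: "stored T s" and Y: "assigned Y s" and p: "s ''p'' 0 = int p" "p < n" "Y p = 0"
    and e: "s ''e'' 0 = gain T Y"
  shows "achieves K greedy_com 10 (\<lambda>s'. assigned (greedy T p Y) s' \<and> s' ''e'' 0 = gain T (greedy T p Y)) s"
  unfolding greedy_com_def
proof (rule achieves_Seq[where i = 0 and j = 9])
  let ?y = "Assign ''y'' (V ''p'') (Const 1)"
  let ?c = "Cond (Less (V ''g'') (V ''e''))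
         (Seq (Assign ''y'' (V ''p'') (Const (-1))) (Set ''e'' (Sub (Add (V ''e'') (V ''e'')) (V ''g''))))
         (Set ''e'' (V ''g''))"
  show "achieves K ?y 0 (assigned (Y(p := 1))) s"
    using Y p by (intro achieves_Assign) (auto simp: assigned_def)
  fix s' assume Y': "assigned (Y(p := 1)) s'" and F: "\<forall>a. a \<notin> writes ?y \<longrightarrow> s' a = s a"
  have T': "stored T s'" using T by (rule stored_frame) (use F in simp_all)
  show "achieves K (Seq gain_com ?c) 9
      (\<lambda>s'. assigned (greedy T p Y) s' \<and> s' ''e'' 0 = gain T (greedy T p Y)) s'"
  proof (rule achieves_Seq[OF achieves_gain[OF T' Y'], where j = 2])
    fix t assume g: "t ''g'' 0 = gain T (Y(p := 1))" and Ft: "\<forall>a. a \<notin> writes gain_com \<longrightarrow> t a = s' a"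
    have Yt: "assigned (Y(p := 1)) t" using Y' by (rule assigned_frame) (use Ft in simp)
    have pe: "t ''p'' 0 = int p" "t ''e'' 0 = gain T Y" using p e F Ft by auto
    show "achieves K ?c 2 (\<lambda>s'. assigned (greedy T p Y) s' \<and> s' ''e'' 0 = gain T (greedy T p Y)) t"
    proof (rule achieves_Cond[where i = 1])
      assume "bval (Less (V ''g'') (V ''e'')) t"
      then have gr: "greedy T p Y = Y(p := -1)" using g pe by (simp add: greedy_def)
      show "achieves K (Seq (Assign ''y'' (V ''p'') (Const (-1))) (Set ''e'' (Sub (Add (V ''e'') (V ''e'')) (V ''g'')))) 1
          (\<lambda>s'. assigned (greedy T p Y) s' \<and> s' ''e'' 0 = gain T (greedy T p Y)) t"
      proof (rule achieves_Seq[where i = 0 and j = 0])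
        show "achieves K (Assign ''y'' (V ''p'') (Const (-1))) 0 (assigned (Y(p := -1))) t"
          using Yt pe by (intro achieves_Assign) (auto simp: assigned_def)
        fix u assume "assigned (Y(p := -1)) u"
          and "\<forall>a. a \<notin> writes (Assign ''y'' (V ''p'') (Const (-1))) \<longrightarrow> u a = t a"
        then show "achieves K (Set ''e'' (Sub (Add (V ''e'') (V ''e'')) (V ''g''))) 0
            (\<lambda>s'. assigned (greedy T p Y) s' \<and> s' ''e'' 0 = gain T (greedy T p Y)) u"
          using g pe gr gain_upd[where T = T and y = Y, OF p(2,3)] by (intro achieves_Assign) (auto simp: assigned_def)
      qed simp_all
    next
      assume "\<not> bval (Less (V ''g'') (V ''e'')) t"
      then have gr: "greedy T p Y = Y(p := 1)" using g pe by (simp add: greedy_def)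
      show "achieves K (Set ''e'' (V ''g'')) 1
          (\<lambda>s'. assigned (greedy T p Y) s' \<and> s' ''e'' 0 = gain T (greedy T p Y)) t"
        using gr g Yt by (intro achieves_Assign) (auto simp: assigned_def)
    qed simp_all
  qed simp_all
qed simp_all

lemma achieves_solution:
  assumes T: "stored final s" and y: "\<And>q. q < n \<Longrightarrow> s ''y'' (int q) = 0" and e: "s ''e'' 0 = 0"
  shows "achieves K solution_com 13 (assigned solution) s"
  unfolding solution_com_def
proof (rule achieves_Seq[where i = 12 and j = 12])
  let ?I = "\<lambda>Y s. assigned Y s \<and> s ''e'' 0 = gain final Y"
  let ?c = "Cond (Pos (Cell ''m'' ''p'')) greedy_com Skip"
  let ?d = "Cond (Pos (Cell ''m'' ''p'')) Skip greedy_com"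
  have cell: "aval (Cell ''m'' ''p'') t = val (final m k)" if "stored final t" "t ''p'' 0 = int k" "k < n" for t k
    using aval_Cell[OF that(1) stored_scalars(2)[OF that(1)] that(2)] that(3) by simp
  show "achieves K (For ''p'' ''n'' ?c) 12 (?I (target_stage n)) s"
  proof (rule achieves_For[where L = n and j = 11 and I = "\<lambda>k. ?I (target_stage k)"])
    show "s ''n'' 0 = int n" using T by (rule stored_scalars)
    \<comment> \<open>The untouched cells already represent the empty assignment, and
      \<open>gain_zero\<close> makes the cached value 0 correct.\<close>
    show "?I (target_stage 0) (s(''p'' := (s ''p'')(0 := 0)))"
      using y e gain_zero by (simp add: assigned_def target_stage_def)
    fix k t assume k: "k < n" "?I (target_stage k) t" "t ''p'' 0 = int k"
      and F: "\<forall>a. a \<notin> insert ''p'' (writes ?c) \<longrightarrow> t a = s a"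
    have Tt: "stored final t" using T by (rule stored_frame) (use F in simp_all)
    have S: "target_stage (Suc k) = (if final m k = 1 then greedy final k (target_stage k) else target_stage k)"
      by (simp add: target_stage_def)
    have z: "target_stage k k = 0" using target_stage[OF w_nonneg, of k] k(1) by auto
    have "achieves K ?c 11 (?I (target_stage (Suc k))) t"
    proof (rule achieves_Cond[where i = 10])
      assume "bval (Pos (Cell ''m'' ''p'')) t"
      then have "target_stage (Suc k) = greedy final k (target_stage k)" using S cell[OF Tt k(3,1)] by simp
      then show "achieves K greedy_com 10 (?I (target_stage (Suc k))) t"
        using achieves_greedy[where Y = "target_stage k", OF Tt _ k(3,1) z] k(2) by simp
    next
      assume "\<not> bval (Pos (Cell ''m'' ''p'')) t"
      then have "target_stage (Suc k) = target_stage k" using S cell[OF Tt k(3,1)] by simp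
      then show "achieves K Skip 10 (?I (target_stage (Suc k))) t"
        using k(2) by (intro achieves_Skip) simp_all
    qed simp_all
    then show "achieves K ?c 11 (\<lambda>u. ?I (target_stage (Suc k)) (u(''p'' := (u ''p'')(0 := int (Suc k))))) t"
      by (rule achieves_mono) (simp_all add: assigned_def)
  qed simp_all
  fix s' assume s': "?I (target_stage n) s'" and F': "\<forall>a. a \<notin> writes (For ''p'' ''n'' ?c) \<longrightarrow> s' a = s a"
  have T': "stored final s'" using T by (rule stored_frame) (use F' in simp_all)
  show "achieves K (For ''p'' ''n'' ?d) 12 (assigned solution) s'"
  proof (rule achieves_For[where L = n and j = 11 and I = "\<lambda>k. ?I (rest_stage k)"])
    show "s' ''n'' 0 = int n" using T' by (rule stored_scalars)
    show "?I (rest_stage 0) (s'(''p'' := (s' ''p'')(0 := 0)))"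
      using s' by (simp add: assigned_def rest_stage_def)
    fix k t assume k: "k < n" "?I (rest_stage k) t" "t ''p'' 0 = int k"
      and F: "\<forall>a. a \<notin> insert ''p'' (writes ?d) \<longrightarrow> t a = s' a"
    have Tt: "stored final t" using T' by (rule stored_frame) (use F in simp_all)
    have S: "rest_stage (Suc k) = (if final m k = 1 then rest_stage k else greedy final k (rest_stage k))"
      by (simp add: rest_stage_def)
    have "achieves K ?d 11 (?I (rest_stage (Suc k))) t"
    proof (rule achieves_Cond[where i = 10])
      assume "bval (Pos (Cell ''m'' ''p'')) t"
      then have "rest_stage (Suc k) = rest_stage k" using S cell[OF Tt k(3,1)] by simp
      then show "achieves K Skip 10 (?I (rest_stage (Suc k))) t"
        using k(2) by (intro achieves_Skip) simp_all
    next
      assume "\<not> bval (Pos (Cell ''m'' ''p'')) t"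
      then have mk: "final m k = 0" using cell[OF Tt k(3,1)] by simp
      then have z: "rest_stage k k = 0" using rest_stage[of k] k(1) by auto
      show "achieves K greedy_com 10 (?I (rest_stage (Suc k))) t"
        using achieves_greedy[where Y = "rest_stage k", OF Tt _ k(3,1) z] k(2) S mk by simp
    qed simp_all
    then show "achieves K ?d 11 (\<lambda>u. ?I (rest_stage (Suc k)) (u(''p'' := (u ''p'')(0 := int (Suc k))))) t"
      by (rule achieves_mono) (simp_all add: assigned_def)
  qed simp_all
qed simp_all

lemma achieves_output:
  assumes T: "stored T s" and Y: "assigned Y s"
  shows "achieves K output_com 8 (\<lambda>s'. \<forall>i<n. s' ''x'' (int i) = rowprod T Y (m + 1 + i)) s"
  unfolding output_com_def
proof (rule achieves_For[where L = n and j = 7 and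
      I = "\<lambda>k s. \<forall>i<k. s ''x'' (int i) = rowprod T Y (m + 1 + i)"])
  let ?l = "Set ''l'' (Add (Add (V ''m'') (V ''i'')) (Const 1))"
  let ?x = "Assign ''x'' (V ''i'') (V ''z'')"
  let ?c = "Seq ?l (Seq (Set ''z'' (Const 1)) (Seq (rowprod_com ''l'') ?x))"
  show "s ''n'' 0 = int n" using T by (rule stored_scalars)
  fix k t assume k: "k < n" "t ''i'' 0 = int k" and I: "\<forall>i<k. t ''x'' (int i) = rowprod T Y (m + 1 + i)"
    and F: "\<forall>a. a \<notin> insert ''i'' (writes ?c) \<longrightarrow> t a = s a"
  have Tt: "stored T t" using T by (rule stored_frame) (use F in simp_all)
  have Yt: "assigned Y t" using Y by (rule assigned_frame) (use F in simp)
  show "achieves K ?c 7 (\<lambda>u. \<forall>i<Suc k. (u(''i'' := (u ''i'')(0 := int (Suc k)))) ''x'' (int i) =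
      rowprod T Y (m + 1 + i)) t"
  proof (rule achieves_Seq[where i = 0 and j = 6])
    show "achieves K ?l 0 (\<lambda>u. u ''l'' 0 = int (m + 1 + k)) t"
      using stored_scalars(2)[OF Tt] k by (intro achieves_Assign) simp_all
    fix u assume l: "u ''l'' 0 = int (m + 1 + k)" and Fu: "\<forall>a. a \<notin> writes ?l \<longrightarrow> u a = t a"
    show "achieves K (Seq (Set ''z'' (Const 1)) (Seq (rowprod_com ''l'') ?x)) 6
      (\<lambda>u. \<forall>i<Suc k. (u(''i'' := (u ''i'')(0 := int (Suc k)))) ''x'' (int i) = rowprod T Y (m + 1 + i)) u"
    proof (rule achieves_Seq[where i = 0 and j = 5])
      show "achieves K (Set ''z'' (Const 1)) 0 (\<lambda>v. v ''z'' 0 = 1) u" by (intro achieves_Assign) simp_all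
      fix v assume z: "v ''z'' 0 = 1" and Fv: "\<forall>a. a \<notin> writes (Set ''z'' (Const 1)) \<longrightarrow> v a = u a"
      have Tv: "stored T v" using Tt by (rule stored_frame) (use Fu Fv in simp_all)
      have Yv: "assigned Y v" using Yt by (rule assigned_frame) (use Fu Fv in simp)
      have lv: "v ''l'' 0 = int (m + 1 + k)" "v ''i'' 0 = int k" "v ''x'' = t ''x''" using l k Fu Fv by simp_all
      show "achieves K (Seq (rowprod_com ''l'') ?x) 5
        (\<lambda>u. \<forall>i<Suc k. (u(''i'' := (u ''i'')(0 := int (Suc k)))) ''x'' (int i) = rowprod T Y (m + 1 + i)) v"
      proof (rule achieves_Seq[where i = 4 and j = 0])
        show "achieves K (rowprod_com ''l'') 4 (\<lambda>w. w ''z'' 0 = v ''z'' 0 * rowprod T Y (m + 1 + k)) v"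
          using Tv Yv lv(1) by (rule achieves_rowprod) (use k in simp_all)
        fix w assume "w ''z'' 0 = v ''z'' 0 * rowprod T Y (m + 1 + k)"
          and "\<forall>a. a \<notin> writes (rowprod_com ''l'') \<longrightarrow> w a = v a"
        then show "achieves K ?x 0 (\<lambda>u. \<forall>i<Suc k. (u(''i'' := (u ''i'')(0 := int (Suc k)))) ''x'' (int i) =
            rowprod T Y (m + 1 + i)) w"
          using z lv I by (intro achieves_Assign) (simp_all add: less_Suc_eq)
      qed simp_all
    qed simp_all
  qed simp_all
qed simp_all

lemma achieves_setup:
  assumes nm: "s ''n'' 0 = int n" "s ''m'' 0 = int m" and h: "s ''h'' 0 = 0"
    and bw: "\<And>j. j < m \<Longrightarrow> s ''b'' (int j) = b j" "\<And>j. j < m \<Longrightarrow> s ''w'' (int j) = w j"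
    and A: "\<And>l q. l \<le> m + n \<Longrightarrow> q < n \<Longrightarrow>
      s ''A'' (int l * int n + int q) = (if l < m then val (A l q) else 0)"
  shows "achieves K setup_com 5 (stored T0) s"
  unfolding setup_com_def
proof (rule achieves_Seq[where i = 0 and j = 4])
  let ?N = "Set ''N'' (Add (Add (V ''n'') (V ''m'')) (Const 1))"
  let ?h = "Set ''h'' (Add (V ''h'') (V ''n''))"
  let ?R = "Seq (Assign ''R'' (V ''l'') (V ''h'')) ?h"
  let ?a1 = "Assign ''A'' (Add (Read ''R'' (V ''m'')) (V ''q'')) (Const 1)"
  let ?a2 = "Assign ''A'' (Add (Read ''R'' (Add (V ''m'') (Add (V ''q'') (Const 1)))) (V ''q'')) (Const 1)"
  show "achieves K ?N 0 (\<lambda>t. t ''N'' 0 = int (m + n + 1)) s" using nm by (intro achieves_Assign) simp_all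
  fix t assume N: "t ''N'' 0 = int (m + n + 1)" and Ft: "\<forall>a. a \<notin> writes ?N \<longrightarrow> t a = s a"
  show "achieves K (Seq (For ''l'' ''N'' ?R) (For ''q'' ''n'' (Seq ?a1 ?a2))) 4 (stored T0) t"
  proof (rule achieves_Seq[where i = 2 and j = 3])
    show "achieves K (For ''l'' ''N'' ?R) 2 (\<lambda>u. \<forall>l<m + n + 1. u ''R'' (int l) = int l * int n) t"
    proof (rule achieves_For[where L = "m + n + 1" and j = 1 and
          I = "\<lambda>k u. (\<forall>l<k. u ''R'' (int l) = int l * int n) \<and> u ''h'' 0 = int k * int n"])
      fix k u assume k: "u ''l'' 0 = int k"
        and I: "(\<forall>l<k. u ''R'' (int l) = int l * int n) \<and> u ''h'' 0 = int k * int n"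
        and Fu: "\<forall>a. a \<notin> insert ''l'' (writes ?R) \<longrightarrow> u a = t a"
      have n: "u ''n'' 0 = int n" using Fu Ft nm by simp
      show "achieves K ?R 1 (\<lambda>u. (\<forall>l<Suc k. (u(''l'' := (u ''l'')(0 := int (Suc k)))) ''R'' (int l) = int l * int n) \<and>
          (u(''l'' := (u ''l'')(0 := int (Suc k)))) ''h'' 0 = int (Suc k) * int n) u"
      proof (rule achieves_Seq[where i = 0 and j = 0])
        show "achieves K (Assign ''R'' (V ''l'') (V ''h'')) 0 (\<lambda>u. \<forall>l<Suc k. u ''R'' (int l) = int l * int n) u"
          using I k by (intro achieves_Assign) (simp_all add: less_Suc_eq)
        fix v assume "\<forall>l<Suc k. v ''R'' (int l) = int l * int n"
          and "\<forall>a. a \<notin> writes (Assign ''R'' (V ''l'') (V ''h'')) \<longrightarrow> v a = u a"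
        then show "achieves K ?h 0 (\<lambda>u. (\<forall>l<Suc k. (u(''l'' := (u ''l'')(0 := int (Suc k)))) ''R'' (int l) = int l * int n) \<and>
          (u(''l'' := (u ''l'')(0 := int (Suc k)))) ''h'' 0 = int (Suc k) * int n) v"
          using I n by (intro achieves_Assign) (simp_all add: algebra_simps)
      qed simp_all
    qed (use N Ft h in simp_all)
    fix u assume R: "\<forall>l<m + n + 1. u ''R'' (int l) = int l * int n"
      and Fu: "\<forall>a. a \<notin> writes (For ''l'' ''N'' ?R) \<longrightarrow> u a = t a"
    \<comment> \<open>The state in which the ones of the added rows have been written in the first
      \<open>k\<close> columns.\<close>
    let ?T = "\<lambda>k l q. if l < m then A l q else if l = m then of_bool (q < k) else of_bool (l = m + 1 + q \<and> q < k)"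
    have u: "stored (?T 0) u" unfolding stored_def using R nm bw A N Ft Fu by simp
    show "achieves K (For ''q'' ''n'' (Seq ?a1 ?a2)) 3 (stored T0) u"
    proof (rule achieves_For[where L = n and j = 1 and I = "\<lambda>k. stored (?T k)"])
      show "u ''n'' 0 = int n" using u by (rule stored_scalars)
      show "stored (?T 0) (u(''q'' := (u ''q'')(0 := 0)))" using u by (simp add: stored_update_var)
      fix v assume "stored (?T n) v"
      then show "stored T0 v" by (rule stored_cong) (simp add: T0_def)
    next
      fix k v assume k: "k < n" "v ''q'' 0 = int k" and I: "stored (?T k) v"
      let ?T' = "\<lambda>l q. if l = m \<and> q = k then 1 else ?T k l q"
      show "achieves K (Seq ?a1 ?a2) 1 (\<lambda>v. stored (?T (Suc k)) (v(''q'' := (v ''q'')(0 := int (Suc k))))) v"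
      proof (rule achieves_Seq[where i = 0 and j = 0])
        show "achieves K ?a1 0 (stored ?T') v"
          using stored_update[OF I, of m k 1] stored_scalars(2)[OF I] stored_scalars(4)[OF I, of m] k
          by (intro achieves_Assign) simp_all
        fix z assume z: "stored ?T' z" and "\<forall>a. a \<notin> writes ?a1 \<longrightarrow> z a = v a"
        then have q: "z ''q'' 0 = int k" using k by simp
        have "stored (?T (Suc k)) (z(''A'' := (z ''A'')(int (m + 1 + k) * int n + int k := val 1)))"
        proof (rule stored_cong[OF stored_update[OF z]])
          show "m + 1 + k \<le> m + n" "k < n" using k by simp_all
          show "(if l = m + 1 + k \<and> q = k then 1 else ?T' l q) = ?T (Suc k) l q" for l q
            by (auto simp: less_Suc_eq)
        qed
        moreover have "z ''R'' (int m + (int k + 1)) = int (m + 1 + k) * int n"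
          using stored_scalars(4)[OF z, of "m + 1 + k"] k(1) by (simp add: add_ac)
        ultimately show "achieves K ?a2 0 (\<lambda>v. stored (?T (Suc k)) (v(''q'' := (v ''q'')(0 := int (Suc k))))) z"
          using stored_scalars(2)[OF z] q by (intro achieves_Assign) (simp_all add: stored_update_var)
      qed simp_all
    qed simp_all
  qed simp_all
qed simp_all

lemma achieves_maxlin:
  assumes nm: "s ''n'' 0 = int n" "s ''m'' 0 = int m"
    and bw: "\<And>j. j < m \<Longrightarrow> s ''b'' (int j) = b j" "\<And>j. j < m \<Longrightarrow> s ''w'' (int j) = w j"
    and A: "\<And>l q. l \<le> m + n \<Longrightarrow> q < n \<Longrightarrow>
      s ''A'' (int l * int n + int q) = (if l < m then val (A l q) else 0)"
    and z: "s ''h'' 0 = 0" "s ''e'' 0 = 0" "\<And>q. s ''y'' q = 0"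
  shows "achieves K maxlin_com 16 (\<lambda>s'. \<forall>i<n. s' ''x'' (int i) = rowprod final solution (m + 1 + i)) s"
  unfolding maxlin_com_def
proof (rule achieves_Seq[where i = 5 and j = 15])
  show "achieves K setup_com 5 (stored T0) s" using nm z(1) bw A by (rule achieves_setup)
  fix t assume t: "stored T0 t" and Ft: "\<forall>a. a \<notin> writes setup_com \<longrightarrow> t a = s a"
  show "achieves K (Seq tableau_com (Seq solution_com output_com)) 15
    (\<lambda>s'. \<forall>i<n. s' ''x'' (int i) = rowprod final solution (m + 1 + i)) t"
  proof (rule achieves_Seq[OF achieves_tableau[OF t], where j = 14])
    fix u assume u: "stored final u" and Fu: "\<forall>a. a \<notin> writes tableau_com \<longrightarrow> u a = t a"
    show "achieves K (Seq solution_com output_com) 14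
      (\<lambda>s'. \<forall>i<n. s' ''x'' (int i) = rowprod final solution (m + 1 + i)) u"
    proof (rule achieves_Seq[where i = 13 and j = 8])
      show "achieves K solution_com 13 (assigned solution) u"
        using u by (rule achieves_solution) (use Ft Fu z in simp_all)
      fix v assume "assigned solution v" and Fv: "\<forall>a. a \<notin> writes solution_com \<longrightarrow> v a = u a"
      have "stored final v" using u by (rule stored_frame) (use Fv in simp_all)
      then show "achieves K output_com 8
          (\<lambda>s'. \<forall>i<n. s' ''x'' (int i) = rowprod final solution (m + 1 + i)) v"
        using \<open>assigned solution v\<close> by (rule achieves_output)
    qed simp_all
  qed simp_all
qed simp_all

end

section \<open>Irreducible systems\<close>

text \<open>Rule 1 replaces two equations by at most one, so its result is shorter and cannot equal
  the system.\<close>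

lemma irreducible_distinct:
  assumes "irreducible_system S"
  shows "distinct (map supp (eqs S))"
proof (rule ccontr)
  assume "\<not> ?thesis"
  then obtain us vs ws I where "map supp (eqs S) = us @ [I] @ vs @ [I] @ ws"
    using not_distinct_decomp by blast
  then obtain xs e ys e' zs where e: "eqs S = xs @ e # ys @ e' # zs" "supp e = supp e'"
    by (fastforce simp: map_eq_append_conv map_eq_Cons_conv append_eq_map_conv Cons_eq_map_conv)
  have "S = WSystem (vars S) (xs @ e # ys @ e' # zs)" using e(1) by (cases S) simp
  then have "rule1 S (WSystem (vars S) (xs @ merge e e' @ ys @ zs))"
    using rule1.intros[OF e(2)] by metis
  then have "WSystem (vars S) (xs @ merge e e' @ ys @ zs) = S"
    using assms unfolding irreducible_system_def by blast
  then have "eqs S = xs @ merge e e' @ ys @ zs" by (metis wsystem.sel(2))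
  then have "length (xs @ e # ys @ e' # zs) = length (xs @ merge e e' @ ys @ zs)" using e(1) by metis
  then have "length (merge e e') = 2" by simp
  then show False by (simp add: merge_def split: if_splits)
qed

text \<open>A maximal independent set of columns has as many elements as the rank. Choosing one
  variable for each of its columns gives a set to which Rule 2 applies; since the rule changes
  nothing, the chosen set is the whole variable set. This also excludes two variables with equal
  columns.\<close>

lemma irreducible_indep_cols:
  assumes "irreducible_system S" "finite (vars S)"
  shows "indep_cols S (vars S)"
proof -
  let ?m = "length (eqs S)"
  interpret vec_space "TYPE(bit)" ?m .
  have C: "coeff_mat S \<in> carrier_mat ?m (card (vars S))"     using mat_of_cols_carrier(1)[of ?m "map (coeff_col S) (sorted_list_of_set (vars S))"] assms(2)
    by (simp add: coeff_mat_def)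
  have cols: "set (cols (coeff_mat S)) = coeff_col S ` vars S"
  proof -
    have "cols (coeff_mat S) = map (coeff_col S) (sorted_list_of_set (vars S))"
      unfolding coeff_mat_def by (rule cols_mat_of_cols) (auto simp: coeff_col_def)
    then show ?thesis using assms(2) by simp
  qed
  obtain X where X: "maximal X (\<lambda>T. T \<subseteq> set (cols (coeff_mat S)) \<and> lin_indpt T)"
    using maximal_exists_superset[of "set (cols (coeff_mat S))"
        "\<lambda>T. T \<subseteq> set (cols (coeff_mat S)) \<and> lin_indpt T" "{}"] finite_lin_indpt2
    by (meson List.finite_set empty_iff empty_subsetI finite.emptyI)
  then have "X \<subseteq> coeff_col S ` vars S" and li: "lin_indpt X" using cols by (auto simp: maximal_def)
  then obtain B where B: "B \<subseteq> vars S" "inj_on (coeff_col S) B" "X = coeff_col S ` B"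
    by (auto simp: subset_image_inj)
  have "card B = coeff_rank S"
    using rank_card_indpt[OF C X] B by (simp add: coeff_rank_def card_image)
  moreover have "indep_cols S B" using B li by (simp add: indep_cols_def)
  ultimately have "WSystem B (map (\<lambda>e. Equation (supp e \<inter> B) (rhs e) (weight e)) (eqs S)) = S"
    using rule2.intros[OF B(1)] assms(1) unfolding irreducible_system_def by blast
  then have "B = vars S" by (metis wsystem.sel(1))
  then show ?thesis using \<open>indep_cols S B\<close> by simp
qed

text \<open>There are as many independent columns as variables, in a space whose dimension is the
  number of equations.\<close>

lemma irreducible_card_le:
  assumes "irreducible_system S" "finite (vars S)"
  shows "card (vars S) \<le> length (eqs S)"
proof -
  let ?m = "length (eqs S)"
  interpret vec_space "TYPE(bit)" ?m .
  have "inj_on (coeff_col S) (vars S)" "lin_indpt (coeff_col S ` vars S)"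
    using irreducible_indep_cols[OF assms] by (simp_all add: indep_cols_def)
  moreover have "coeff_col S ` vars S \<subseteq> carrier_vec ?m" by (auto simp: coeff_col_def)
  ultimately show ?thesis
    using li_le_dim(2)[OF fin_dim, of "coeff_col S ` vars S"] dim_is_n by (simp add: card_image)
qed

text \<open>A nonzero \<open>v\<close> would provide the coefficients of a linear dependence among
  the distinct columns.\<close>

lemma irreducible_cols:
  assumes S: "irreducible_system S" "vars S = {0..<n}"
    and v: "\<And>j. j < length (eqs S) \<Longrightarrow> (\<Sum>i<n. of_bool (i \<in> supp (eqs S ! j)) * v i) = (0::bit)"
    and i: "i < n"
  shows "v i = 0"
proof (rule ccontr)
  assume vi: "v i \<noteq> 0"
  let ?m = "length (eqs S)"
  interpret vec_space "TYPE(bit)" ?m .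
  let ?C = "mat_of_cols ?m (map (coeff_col S) [0..<n])"
  have ind: "inj_on (coeff_col S) {0..<n}" "lin_indpt (coeff_col S ` {0..<n})"
    using irreducible_indep_cols[OF S(1)] S(2) by (simp_all add: indep_cols_def)
  have cols: "cols ?C = map (coeff_col S) [0..<n]"
    by (rule cols_mat_of_cols) (auto simp: coeff_col_def)
  have "lin_dep (set (cols ?C))"
  proof (rule lin_depI[where nc = n and v = "vec n v"])
    show "?C \<in> carrier_mat ?m n" using mat_of_cols_carrier(1)[of ?m "map (coeff_col S) [0..<n]"] by simp
    show "vec n v \<in> carrier_vec n" by simp
    show "vec n v \<noteq> 0\<^sub>v n" using vi i by (metis index_vec index_zero_vec(1))
    show "?C *\<^sub>v vec n v = 0\<^sub>v ?m"
    proof (rule eq_vecI)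
      fix j assume j: "j < dim_vec (0\<^sub>v ?m)"
      have "(?C *\<^sub>v vec n v) $ j = (\<Sum>i<n. ?C $$ (j, i) * v i)"
        using j by (simp add: scalar_prod_def atLeast0LessThan)
      also have "\<dots> = (\<Sum>i<n. of_bool (i \<in> supp (eqs S ! j)) * v i)"
        using j by (intro sum.cong) (simp_all add: mat_of_cols_index coeff_col_def)
      finally show "(?C *\<^sub>v vec n v) $ j = 0\<^sub>v ?m $ j" using v j by simp
    qed simp
    show "distinct (cols ?C)" using ind(1) by (simp add: cols distinct_map)
  qed
  then show False using ind(2) by (simp add: cols)
qed

section \<open>From the tableau back to weighted systems\<close>

theorem theorem4:
  shows "\<exists>(P :: com) (c :: nat) (d :: nat).
    \<forall>(S :: wsystem) (n :: nat) (m :: nat) (r :: nat) (k :: nat).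
      weighted_system S \<longrightarrow> vars S = {0..<n} \<longrightarrow> length (eqs S) = m \<longrightarrow>
      irreducible_system S \<longrightarrow>
      (\<forall>e\<in>set (eqs S). card (supp e) \<le> r) \<longrightarrow>
      k > 0 \<longrightarrow> n \<ge> (k - 1) * r + 1 \<longrightarrow>
      (\<exists>t s. exec P (input_store S r k) t s \<and> t \<le> c * m ^ d \<and>
        (\<forall>i<n. output_assignment s i \<in> {-1, 1}) \<and>
        excess S (output_assignment s) \<ge> int k * min_weight S)"
proof (rule exI[of _ maxlin_com], rule exI[of _ "11 ^ 16"], rule exI[of _ 16], intro allI impI)
  fix S n m r k
  assume S: "weighted_system S" "vars S = {0..<n}" "length (eqs S) = m" "irreducible_system S"
    and r: "\<forall>e\<in>set (eqs S). card (supp e) \<le> r" and k: "k > 0" "n \<ge> (k - 1) * r + 1"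
  define A where "A j i = (of_bool (i \<in> supp (eqs S ! j)) :: bit)" for j i
  define w where "w j = weight (eqs S ! j)" for j
  define b where "b j = rhs (eqs S ! j)" for j
  have eq: "supp (eqs S ! j) \<noteq> {}" "supp (eqs S ! j) \<subseteq> {..<n}" "b j \<in> {-1, 1}" "0 < w j"
    "card (supp (eqs S ! j)) \<le> r" if "j < m" for j
    using S r that nth_mem[of j "eqs S"] unfolding weighted_system_def b_def w_def by fastforce+
  have A1: "A j i = 1 \<longleftrightarrow> i \<in> supp (eqs S ! j)" for j i by (simp add: A_def)
  interpret maxlin n m A w b
  proof
    show "v i = 0" if "\<And>j. j < m \<Longrightarrow> (\<Sum>i<n. A j i * v i) = 0" "i < n" for v i
      using irreducible_cols[OF S(4,2)] that S(3) unfolding A_def by blast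
    show "\<exists>i<n. A j i = 1" if "j < m" for j using eq(1,2)[OF that] unfolding A1 by blast
    show "j = j'" if j: "j < m" "j' < m" and A: "\<And>i. i < n \<Longrightarrow> A j i = A j' i" for j j'
    proof -
      have "supp (eqs S ! j) = supp (eqs S ! j')"
        using eq(2)[OF j(1)] eq(2)[OF j(2)] A A1 by (metis lessThan_iff subsetD subsetI subset_antisym)
      then show ?thesis using irreducible_distinct[OF S(4)] j S(3) by (simp add: distinct_conv_nth) metis
    qed
  qed (use eq in auto)
  have nm: "0 < n" "n \<le> m" using k irreducible_card_le[OF S(4)] S by auto
  have "achieves K maxlin_com 16 (\<lambda>s. \<forall>i<n. s ''x'' (int i) = rowprod final solution (m + 1 + i))
      (input_store S r k)"
  proof (rule achieves_maxlin)
    fix l q assume l: "l \<le> m + n" "q < n"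
    have p: "int l * int n + int q = int (l * n + q)" by simp
    have A_in: "input_store S r k ''A'' a =
        (if 0 \<le> a \<and> a < int (m * n) \<and> nat a mod n \<in> supp (eqs S ! (nat a div n)) then 1 else 0)" for a
      using S by (simp add: input_store_def)
    have "(l * n + q) mod n = q" "(l * n + q) div n = l" using l by simp_all
    \<comment> \<open>Cells of rows from \<open>m\<close> on lie beyond the stored incidence matrix
      and therefore hold 0.\<close>
    moreover have "l * n + q < m * n \<longleftrightarrow> l < m"
    proof
      assume "l < m"
      then have "Suc l * n \<le> m * n" by (intro mult_le_mono1) simp
      then show "l * n + q < m * n" using l by simp
    next
      assume "l * n + q < m * n"
      then have "l * n < m * n" by (rule le_less_trans[rotated]) simp
      then show "l < m" by simp
    qed
    ultimately show "input_store S r k ''A'' (int l * int n + int q) = (if l < m then val (A l q) else 0)"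
      unfolding p A_in A1 nat_int of_nat_less_iff by simp
  qed (use S in \<open>simp_all add: input_store_def w_def b_def\<close>)
  then obtain t s where s: "exec maxlin_com (input_store S r k) t s" "t \<le> K ^ 16"
    "\<And>i. i < n \<Longrightarrow> output_assignment s i = rowprod final solution (m + 1 + i)"
    unfolding achieves_def output_assignment_def by blast
  \<comment> \<open>Here \<open>K\<close> is \<open>3 * m + 3 * n + 5\<close>, and
    \<open>1 \<le> n \<le> m\<close> bounds it by \<open>11 * m\<close>.\<close>
  have "K ^ 16 \<le> (11 * m) ^ 16" using nm by (intro power_mono) simp_all
  then have "t \<le> 11 ^ 16 * m ^ 16" using s(2) by (simp only: power_mult_distrib)
  moreover have "output_assignment s i \<in> {-1, 1}" if "i < n" for i
    unfolding s(3)[OF that] by (rule rowprod_sign, rule solution_sign)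
  moreover have "int k * min_weight S \<le> excess S (output_assignment s)"
  proof -
    have "(\<Prod>i\<in>supp (eqs S ! j). output_assignment s i) = rowprod final solution j" if j: "j < m" for j
    proof -
      have "(\<Prod>i\<in>supp (eqs S ! j). output_assignment s i) =
          (\<Prod>i\<in>{..<n} \<inter> supp (eqs S ! j). output_assignment s i)"
        using eq(2)[OF j] by (simp add: Int_absorb1)
      also have "\<dots> = (\<Prod>i<n. if i \<in> supp (eqs S ! j) then output_assignment s i else 1)"
        by (rule prod.inter_restrict) simp
      also have "\<dots> = (\<Prod>i<n. if A j i = 1 then rowprod final solution (m + 1 + i) else 1)"
        by (intro prod.cong) (simp_all add: A1 s(3))
      also have "\<dots> = rowprod final solution j" using j by (rule rowprod_change_of_variables)
      finally show ?thesis .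
    qed
    then have ex: "excess S (output_assignment s) = gain final solution"
      unfolding excess_def gain_def S(3) by (intro sum.cong) (simp_all add: w_def b_def)
    have min: "min_weight S \<le> w j" if "j < m" for j
      using that S(3) unfolding min_weight_def w_def by (intro Min_le) auto
    have "min_weight S \<in> weight ` set (eqs S)"
      unfolding min_weight_def using nm S(3) by (intro Min_in) auto
    then have pos: "0 < min_weight S" using S(1) unfolding weighted_system_def by auto
    have "(\<Sum>i<n. val (A j i)) \<le> int r" if "j < m" for j
    proof -
      have "(\<Sum>i<n. val (A j i)) = int (card ({..<n} \<inter> supp (eqs S ! j)))"
        unfolding A1 by (simp add: Int_def)
      also have "{..<n} \<inter> supp (eqs S ! j) = supp (eqs S ! j)" using eq(2)[OF that] by blast
      finally show ?thesis using eq(5)[OF that] by simp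
    qed
    then have "int n \<le> target_size final * int r" by (rule target_size_bound)
    then have "int (k - 1) * int r < target_size final * int r" using k(2) by (simp flip: of_nat_mult)
    \<comment> \<open>The strict inequality excludes \<open>r = 0\<close>, so the factor
      cancels.\<close>
    then have "int (k - 1) < target_size final" by (simp add: mult_less_cancel_right)
    then have "int k \<le> target_size final" using k(1) by simp
    then have "int k * min_weight S \<le> target_size final * min_weight S" using pos by simp
    also have "\<dots> \<le> gain final solution" using min by (rule gain_solution)
    finally show ?thesis using ex by simp
  qed
  ultimately show "\<exists>t s. exec maxlin_com (input_store S r k) t s \<and> t \<le> 11 ^ 16 * m ^ 16 \<and>
        (\<forall>i<n. output_assignment s i \<in> {-1, 1}) \<and>
        excess S (output_assignment s) \<ge> int k * min_weight S"
    using s(1) by blast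
qed

end
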